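(* In the setting of the context (triangulation $\mathcal T$ of a domain $\Omega\subseteq\mathbb R^n$, $p\in[1,\infty]$, local projections $P_S$ and $\Pi_T$, and the Clément interpolant $\mathcal I_{\mathcal T}$), there exists $C_{\mathcal I}>0$, depending only on $n$, $p$, the polynomial degree $r$, and the shape measure of the triangulation, such that for all $T\in\Delta_n(\mathcal T)$ $$\|\mathcal I_{\mathcal T}\omega\|_{L^p\Lambda^k(T)}\le C_{\mathcal I}\,\|\omega\|_{L^p\Lambda^k(U^\ast_{T,\mathcal T})},\qquad \omega\in L^p\Lambda^k(U^\ast_{T,\mathcal T})$$ (where $\omega$ is extended by zero to $\Omega$), and for all $T\in\Delta_n(\mathcal T)$ and all $\omega\in L^p\Lambda^k(\Omega)$ $$\|\omega-\mathcal I_{\mathcal T}\omega\|_{L^p\Lambda^k(T)}\le C_{\mathcal I}\,\|\omega-\Pi_T\omega\|_{L^p\Lambda^k(T)}+C_{\mathcal I}\sum_{S\subseteq T}\ \sum_{i\in I(S)}\|\omega-P_S\omega\|_{L^p\Lambda^k(U_{S,\mathcal T})},$$ where the sum runs over all subsimplices $S$ of $T$.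
   Context: Triangulation. $\mathcal T$ is a finite $n$-dimensional simplicial complex in $\mathbb R^n$ (every simplex is contained in an $n$-dimensional simplex of $\mathcal T$) that triangulates a domain $\Omega$: $\overline\Omega$ is the union of the simplices and $\Omega$ is the interior of that union. $\Delta_n(\mathcal T)$ is the set of $n$-dimensional simplices. $\mathcal T$ is face-connected: for all $T_0,T\in\Delta_n(\mathcal T)$ with $T_0\cap T\neq\emptyset$ there is a sequence $T_1,\dots,T_N=T$ in $\Delta_n(\mathcal T)$ such that each $F_i=T_i\cap T_{i-1}$ is a common facet of $T_i$ and $T_{i-1}$ with $T_0\cap T\subseteq F_i$. For a simplex $T$ of dimension $d\ge1$, $h_T$ is its diameter and $\mu(T)=h_T^d/\mathrm{vol}^d(T)$; for a vertex $V$, $h_V$ is the minimum length of an edge adjacent to $V$. The shape measure $\mu(\mathcal T)$ is $\sup\mu(T)$ over non-vertex simplices. For $S\in\mathcal T$: $U_{S,\mathcal T}=\bigcup\{T'\in\Delta_n(\mathcal T):S\subseteq T'\}$ and $U^\ast_{S,\mathcal T}=\bigcup\{T'\in\Delta_n(\mathcal T):T'\cap S\ne\emptyset\}$. Function spaces. $L^p\Lambda^k$, $W^{s,p}\Lambda^k$ are the spaces of $k$-forms with coefficients in $L^p$, resp. in the Sobolev–Slobodeckij space $W^{s,p}$ ($s\ge0$ real), with seminorm $|\omega|_{W^{m,p}}=\sum_{|\alpha|=m}\|\partial^\alpha\omega\|_{L^p}$ for integer $m$, and for $\theta\in(0,1)$ $|\omega|_{W^{m+\theta,p}(U)}=\sum_{|\alpha|=m}\big(\iint_{U\times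 U}\frac{|\partial^\alpha\omega(x)-\partial^\alpha\omega(y)|^p}{|x-y|^{n+p\theta}}dxdy\big)^{1/p}$ (essential supremum of $|\partial^\alpha\omega(x)-\partial^\alpha\omega(y)|/|x-y|^\theta$ if $p=\infty$). $\mathcal W^{p,q}\Lambda^k(U)=\{\omega\in L^p\Lambda^k(U):d\omega\in L^q\Lambda^{k+1}(U)\}$. Finite element spaces. Fix $p\in[1,\infty]$, $k\in\mathbb N_0$, $r\in\mathbb N$. $\mathcal P_r\Lambda^k$: $k$-forms with polynomial coefficients of degree at most $r$ (zero for $r<0$ or $k<0$). For $r\ge1$, $\mathcal P^-_r\Lambda^k=\mathcal P_{r-1}\Lambda^k+\kappa\mathcal P_{r-1}\Lambda^{k+1}$ with $\kappa$ the contraction with the position vector field; zero for $r\le0$. $\mathcal P_r\Lambda^k(S),\mathcal P^-_r\Lambda^k(S)$ are the pullbacks to a simplex $S$; $\mathring{\mathcal P}_r\Lambda^k(S),\mathring{\mathcal P}^-_r\Lambda^k(S)$ are the subspaces with vanishing trace $\operatorname{tr}_F$ (pullback) on all proper subsimplices $F$ of $S$. $\mathcal P_r\Lambda^k(\mathcal T)$ (resp. $\mathcal P^-_r\Lambda^k(\mathcal T)$): forms $\omega\in\mathcal W^{\infty,\infty}\Lambda^k(\Omega)$ with $\omega_{|T}\in\mathcal P_r\Lambda^k(T)$ (resp. $\mathcal P_r^-\Lambda^k(T)$) for all $T\in\Delta_n(\mathcal T)$. For $F\in\mathcal T$, $m=\dim F$, $\mathcal C_r\Lambda^k(F)$ is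 the space of functionals $\omega\mapsto\int_F\eta\wedge\operatorname{tr}_F\omega$ with $\eta\in\mathcal P^-_{r+k-m}\Lambda^{m-k}(F)$; $\mathcal C^-_r\Lambda^k(F)$ is the same with $\eta\in\mathcal P_{r+k-m-1}\Lambda^{m-k}(F)$. $\mathcal P\Lambda^k,\mathring{\mathcal P}\Lambda^k,\mathcal C\Lambda^k$ denote either consistently $\mathcal P_r\Lambda^k,\mathring{\mathcal P}_r\Lambda^k,\mathcal C_r\Lambda^k$ or consistently $\mathcal P^-_r\Lambda^k,\mathring{\mathcal P}^-_r\Lambda^k,\mathcal C^-_r\Lambda^k$ (first option if $k=0$, second if $k=n$). $I(S)=\{1,\dots,\dim\mathring{\mathcal P}\Lambda^k(S)\}$. Biorthogonal system. One fixes bases $\{\phi^\ast_{S,i}\}_{i\in I(S)}$ of $\mathcal C\Lambda^k(S)$ for $S\in\mathcal T$ and a basis $\{\phi_{S,i}\}_{S\in\mathcal T,i\in I(S)}$ of $\mathcal P\Lambda^k(\mathcal T)$ with: $\phi^\ast_{S,i}(\phi_{S',j})=1$ if $(S,i)=(S',j)$ and $0$ otherwise; $\operatorname{tr}_{S'}\phi_{S,i}=0$ whenever $S\nsubseteq S'\in\mathcal T$; and for $S\subseteq T\in\Delta_n(\mathcal T)$: $\|\phi_{S,i}\|_{L^p\Lambda^k(T)}\le C_Ah_S^{n/p-k}$ and $\|\phi^\ast_{S,i}(\omega)\phi_{S,i}\|_{L^p\Lambda^k(T)}\le C_A\|\omega\|_{L^p\Lambda^k(T)}$ for all $\omega\in\mathcal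 P_r\Lambda^k(T)$, with $C_A$ depending only on $p,n,r,\mu(\mathcal T)$. Local projections. For each $S\in\mathcal T$, $P_S:L^p\Lambda^k(\Omega)\to\mathcal P_r\Lambda^k(U_{S,\mathcal T})\subset L^p\Lambda^k(\Omega)$ (polynomial forms on the patch, extended by zero) is a fixed idempotent bounded linear map with $\|\omega-P_S\omega\|_{L^p\Lambda^k(U_{S,\mathcal T})}\le C_{BH}h_S^m|\omega|_{W^{m,p}\Lambda^k(U_{S,\mathcal T})}$ for $\omega\in W^{m,p}\Lambda^k(\Omega)$, $m\in[0,r+1]$, and $\|d\omega-dP_S\omega\|_{L^p\Lambda^{k+1}(U_{S,\mathcal T})}\le C_{BH}h_S^l|d\omega|_{W^{l,p}\Lambda^{k+1}(U_{S,\mathcal T})}$ whenever $d\omega\in W^{l,p}\Lambda^{k+1}(\Omega)$, $l\in[0,r]$. For each $T\in\Delta_n(\mathcal T)$, $\Pi_T:L^p\Lambda^k(T)\to\mathcal P\Lambda^k(T)$ is a fixed bounded projection with $\|\omega-\Pi_T\omega\|_{L^p\Lambda^k(T)}\le C_\Pi\inf_{\psi\in\mathcal P\Lambda^k(T)}\|\omega-\psi\|_{L^p\Lambda^k(T)}$ for $\omega\in L^p\Lambda^k(T)$ and $\|d\omega-d\Pi_T\omega\|_{L^p\Lambda^{k+1}(T)}\le C_\Pi\inf_{\psi\in\mathcal P\Lambda^k(T)}\|d\omega-d\psi\|_{L^p\Lambda^{k+1}(T)}$ for $\omega\in\mathcal W^{p,p}\Lambda^k(T)$. $C_{BH},C_\Pi$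 depend only on $n,p,r$ and the shape measure. Clément interpolant. $\mathcal I_{\mathcal T}:L^p\Lambda^k(\Omega)\to\mathcal P\Lambda^k(\mathcal T)$, $\mathcal I_{\mathcal T}\omega=\sum_{S\in\mathcal T}\sum_{i\in I(S)}\phi^\ast_{S,i}(P_S\omega)\,\phi_{S,i}$. *)

theory Defs
  imports
    "HOL-Analysis.Analysis"
    "HOL-Library.Function_Algebras"
    "HOL-Probability.Essential_Supremum"
begin

section \<open>Pointwise vector space structure on functions\<close>

text \<open>Extends \<^theory>\<open>HOL-Library.Function_Algebras\<close>, so that \<^const>\<open>dim\<close>, \<^const>\<open>span\<close> and
  \<^const>\<open>independent\<close> apply to spaces of forms and of functionals.\<close>

instantiation "fun" :: (type, real_vector) real_vector
begin

definition scaleR_fun :: "real \<Rightarrow> ('a \<Rightarrow> 'b) \<Rightarrow> 'a \<Rightarrow> 'b"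
  where "scaleR_fun c f = (\<lambda>x. c *\<^sub>R f x)"

instance
  by standard (auto simp: scaleR_fun_def fun_eq_iff algebra_simps)

end


section \<open>Exterior algebra\<close>

text \<open>The coordinate \<^term>\<open>u $ I\<close> is the coefficient of the basis covector
  $dx_{i_1} \wedge \dots \wedge dx_{i_k}$, where $i_1 < \dots < i_k$ enumerates \<open>I\<close>. The Euclidean
  norm of this type is the norm for which these covectors are orthonormal.\<close>

type_synonym 'n point = "real ^ 'n"
type_synonym 'n covec = "real ^ ('n set)"
type_synonym 'n dform = "'n point \<Rightarrow> 'n covec"

definition covectors :: "nat \<Rightarrow> ('n::{finite,linorder}) covec set"
  where "covectors k = {u. \<forall>I. u $ I \<noteq> 0 \<longrightarrow> card I = k}"

definition wedge :: "('n::{finite,linorder}) covec \<Rightarrow> 'n covec \<Rightarrow> 'n covec"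
  where "wedge u v = (\<chi> K. \<Sum>I\<in>Pow K.
    (- 1) ^ card {(i, j). i \<in> I \<and> j \<in> K - I \<and> j < i} * (u $ I) * (v $ (K - I)))"

definition contract :: "'n point \<Rightarrow> ('n::{finite,linorder}) covec \<Rightarrow> 'n covec"
  where "contract v u = (\<chi> J. \<Sum>i\<in>- J.
    (- 1) ^ card {j \<in> J. j < i} * (v $ i) * (u $ insert i J))"

text \<open>The value $u(v_1, \dots, v_k)$ of the alternating form \<open>u\<close>; for a \<open>k\<close>-covector and a list of a
  length other than \<open>k\<close> it is zero.\<close>

primrec eval_covec :: "('n::{finite,linorder}) covec \<Rightarrow> 'n point list \<Rightarrow> real"
  where
    "eval_covec u [] = u $ {}"
  | "eval_covec u (v # vs) = eval_covec (contract v u) vs"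


section \<open>Lebesgue spaces of forms\<close>

text \<open>Forms are functions on all of $R^n$; as elements of Lebesgue spaces they are considered up to
  equality almost everywhere on the relevant set, and norms take values in \<^typ>\<open>ennreal\<close>.\<close>

definition ennroot :: "ennreal \<Rightarrow> ennreal \<Rightarrow> ennreal"
  where "ennroot p I = (if I = \<infinity> then \<infinity> else ennreal (enn2real I powr (1 / enn2real p)))"

definition Lp_norm :: "ennreal \<Rightarrow> 'n point set \<Rightarrow> ('n::{finite,linorder}) dform \<Rightarrow> ennreal"
  where "Lp_norm p U \<omega> =
    (if p = \<infinity> then esssup (lebesgue_on U) (\<lambda>x. ennreal (norm (\<omega> x)))
     else ennroot p (\<integral>\<^sup>+ x. ennreal (norm (\<omega> x) powr enn2real p) \<partial>lebesgue_on U))"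

definition Lp_forms :: "ennreal \<Rightarrow> nat \<Rightarrow> 'n point set \<Rightarrow> ('n::{finite,linorder}) dform set"
  where "Lp_forms p k U = {\<omega>. \<omega> \<in> borel_measurable (lebesgue_on U) \<and>
    (AE x in lebesgue_on U. \<omega> x \<in> covectors k) \<and> Lp_norm p U \<omega> < \<infinity>}"


section \<open>Weak derivatives and Sobolev--Slobodeckij spaces\<close>

definition pderiv_at :: "'n \<Rightarrow> ('n point \<Rightarrow> real) \<Rightarrow> ('n::{finite,linorder}) point \<Rightarrow> real"
  where "pderiv_at i f x = frechet_derivative f (at x) (axis i 1)"

text \<open>Multi-indices are functions \<open>'n \<Rightarrow> nat\<close>; the order of differentiation is fixed but irrelevant,
  since only smooth functions are differentiated in this way.\<close>

definition pderiv_multi ::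
    "('n \<Rightarrow> nat) \<Rightarrow> ('n point \<Rightarrow> real) \<Rightarrow> ('n::{finite,linorder}) point \<Rightarrow> real"
  where "pderiv_multi \<alpha> f = foldr (\<lambda>i. pderiv_at i ^^ \<alpha> i) (sorted_list_of_set UNIV) f"

definition test_functions :: "'n point set \<Rightarrow> (('n::{finite,linorder}) point \<Rightarrow> real) set"
  where "test_functions U = {\<phi>.
    (\<forall>is. foldr pderiv_at is \<phi> differentiable_on UNIV) \<and>
    (\<exists>K. compact K \<and> K \<subseteq> U \<and> (\<forall>x. x \<notin> K \<longrightarrow> \<phi> x = 0))}"

definition locally_integrable :: "'n point set \<Rightarrow> ('n::{finite,linorder}) dform \<Rightarrow> bool"
  where "locally_integrable U \<omega> \<longleftrightarrow>
    (\<forall>K. compact K \<and> K \<subseteq> U \<longrightarrow> integrable (lebesgue_on K) \<omega>)"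

definition is_weak_deriv ::
    "'n point set \<Rightarrow> ('n \<Rightarrow> nat) \<Rightarrow> ('n::{finite,linorder}) dform \<Rightarrow> 'n dform \<Rightarrow> bool"
  where "is_weak_deriv U \<alpha> \<omega> \<zeta> \<longleftrightarrow> locally_integrable U \<omega> \<and> locally_integrable U \<zeta> \<and>
    (\<forall>\<phi>\<in>test_functions U.
      (LINT x|lebesgue_on U. pderiv_multi \<alpha> \<phi> x *\<^sub>R \<omega> x) =
      (- 1) ^ sum \<alpha> UNIV *\<^sub>R (LINT x|lebesgue_on U. \<phi> x *\<^sub>R \<zeta> x))"

text \<open>A representative of the weak derivative, which is unique up to null sets if it exists.\<close>

definition weak_deriv ::
    "'n point set \<Rightarrow> ('n \<Rightarrow> nat) \<Rightarrow> ('n::{finite,linorder}) dform \<Rightarrow> 'n dform"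
  where "weak_deriv U \<alpha> \<omega> = (if \<forall>i. \<alpha> i = 0 then \<omega> else SOME \<zeta>. is_weak_deriv U \<alpha> \<omega> \<zeta>)"

definition slobodeckij ::
    "ennreal \<Rightarrow> real \<Rightarrow> 'n point set \<Rightarrow> ('n::{finite,linorder}) dform \<Rightarrow> ennreal"
  where "slobodeckij p \<theta> U \<omega> =
    (if p = \<infinity>
     then esssup (lebesgue_on (U \<times> U))
            (\<lambda>(x, y). ennreal (norm (\<omega> x - \<omega> y) / norm (x - y) powr \<theta>))
     else ennroot p (\<integral>\<^sup>+ (x, y). ennreal (norm (\<omega> x - \<omega> y) powr enn2real p /
            norm (x - y) powr (real CARD('n) + enn2real p * \<theta>)) \<partial>lebesgue_on (U \<times> U)))"

text \<open>Here and in the next definition \<open>U\<close> is open.\<close>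

definition sobolev_seminorm ::
    "ennreal \<Rightarrow> real \<Rightarrow> 'n point set \<Rightarrow> ('n::{finite,linorder}) dform \<Rightarrow> ennreal"
  where "sobolev_seminorm p s U \<omega> =
    (\<Sum>\<alpha> | sum \<alpha> UNIV = nat \<lfloor>s\<rfloor>.
      if frac s = 0 then Lp_norm p U (weak_deriv U \<alpha> \<omega>)
      else slobodeckij p (frac s) U (weak_deriv U \<alpha> \<omega>))"

definition sobolev_forms ::
    "ennreal \<Rightarrow> real \<Rightarrow> nat \<Rightarrow> 'n point set \<Rightarrow> ('n::{finite,linorder}) dform set"
  where "sobolev_forms p s k U = {\<omega>\<in>Lp_forms p k U.
    (\<forall>\<alpha>. sum \<alpha> UNIV \<le> nat \<lfloor>s\<rfloor> \<longrightarrow> (\<exists>\<zeta>\<in>Lp_forms p k U. is_weak_deriv U \<alpha> \<omega> \<zeta>)) \<and>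
    sobolev_seminorm p s U \<omega> < \<infinity>}"

definition gradient_covec ::
    "('n point \<Rightarrow> real) \<Rightarrow> ('n::{finite,linorder}) point \<Rightarrow> 'n covec"
  where "gradient_covec \<phi> x = (\<Sum>i\<in>UNIV. pderiv_at i \<phi> x *\<^sub>R axis {i} 1)"

text \<open>The weak form of the Leibniz rule $d(\phi\omega) = d\phi \wedge \omega + \phi\, d\omega$: the integral
  of the left-hand side vanishes componentwise for every test function.\<close>

definition is_weak_ext_deriv ::
    "'n point set \<Rightarrow> ('n::{finite,linorder}) dform \<Rightarrow> 'n dform \<Rightarrow> bool"
  where "is_weak_ext_deriv U \<omega> \<zeta> \<longleftrightarrow> locally_integrable U \<omega> \<and> locally_integrable U \<zeta> \<and>
    (\<forall>\<phi>\<in>test_functions U.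
      (LINT x|lebesgue_on U. wedge (gradient_covec \<phi> x) (\<omega> x)) =
      - (LINT x|lebesgue_on U. \<phi> x *\<^sub>R \<zeta> x))"

definition ext_deriv :: "'n point set \<Rightarrow> ('n::{finite,linorder}) dform \<Rightarrow> 'n dform"
  where "ext_deriv U \<omega> = (SOME \<zeta>. is_weak_ext_deriv U \<omega> \<zeta>)"

definition Wpq_forms ::
    "ennreal \<Rightarrow> ennreal \<Rightarrow> nat \<Rightarrow> 'n point set \<Rightarrow> ('n::{finite,linorder}) dform set"
  where "Wpq_forms p q k U =
    {\<omega>\<in>Lp_forms p k U. \<exists>\<zeta>\<in>Lp_forms q (k + 1) U. is_weak_ext_deriv U \<omega> \<zeta>}"


section \<open>Simplices and triangulations\<close>

definition simplex_dim :: "('n::{finite,linorder}) point set \<Rightarrow> nat"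
  where "simplex_dim S = nat (aff_dim S)"

definition tangent :: "('n::{finite,linorder}) point set \<Rightarrow> 'n point set"
  where "tangent S = span {x - y | x y. x \<in> S \<and> y \<in> S}"

definition frame :: "('n::{finite,linorder}) point set \<Rightarrow> 'n point list"
  where "frame S = (SOME es. distinct es \<and> length es = simplex_dim S \<and>
    (\<forall>e\<in>set es. norm e = 1) \<and> pairwise orthogonal (set es) \<and> span (set es) = tangent S)"

text \<open>An isometric parametrization of the affine hull of \<open>S\<close> by $R^d$, where \<open>d\<close> is the dimension of
  \<open>S\<close>. It is used for \<open>d\<close>-dimensional volumes and for integrals of \<open>d\<close>-forms over \<open>S\<close>, the latter with
  respect to the orientation of \<open>S\<close> given by \<^const>\<open>frame\<close>. Points of $R^d$ are extensional functions on
  \<^term>\<open>{..<d}\<close>; for \<open>d = 0\<close> this is a single point of measure one.\<close>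

definition chart :: "('n::{finite,linorder}) point set \<Rightarrow> (nat \<Rightarrow> real) \<Rightarrow> 'n point"
  where "chart S t = (SOME x. x \<in> S) + (\<Sum>i<simplex_dim S. t i *\<^sub>R (frame S ! i))"

definition chart_domain :: "('n::{finite,linorder}) point set \<Rightarrow> (nat \<Rightarrow> real) set"
  where "chart_domain S = {t \<in> extensional {..<simplex_dim S}. chart S t \<in> S}"

definition simplex_vol :: "('n::{finite,linorder}) point set \<Rightarrow> real"
  where "simplex_vol S = measure (\<Pi>\<^sub>M i\<in>{..<simplex_dim S}. lborel) (chart_domain S)"

definition simplex_integral :: "'n point set \<Rightarrow> ('n::{finite,linorder}) dform \<Rightarrow> real"
  where "simplex_integral S \<omega> =
    (LINT t|(\<Pi>\<^sub>M i\<in>{..<simplex_dim S}. lborel).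
      indicator (chart_domain S) t * eval_covec (\<omega> (chart S t)) (frame S))"

definition top_simplices :: "('n::{finite,linorder}) point set set \<Rightarrow> 'n point set set"
  where "top_simplices \<T> = {T\<in>\<T>. aff_dim T = int CARD('n)}"

text \<open>The library regards the empty set as a simplex and as a face of every simplex; here a simplicial
  complex consists of nonempty simplices only.\<close>

definition triangulates :: "('n::{finite,linorder}) point set set \<Rightarrow> 'n point set \<Rightarrow> bool"
  where "triangulates \<T> \<Omega> \<longleftrightarrow>
    {} \<notin> \<T> \<and> simplicial_complex (insert {} \<T>) \<and>
    (\<forall>S\<in>\<T>. \<exists>T\<in>top_simplices \<T>. S \<subseteq> T) \<and>
    \<Omega> \<noteq> {} \<and> connected \<Omega> \<and> closure \<Omega> = \<Union>\<T> \<and> \<Omega> = interior (\<Union>\<T>)"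

definition face_connected :: "('n::{finite,linorder}) point set set \<Rightarrow> bool"
  where "face_connected \<T> \<longleftrightarrow>
    (\<forall>T0\<in>top_simplices \<T>. \<forall>T\<in>top_simplices \<T>. T0 \<inter> T \<noteq> {} \<longrightarrow>
      (\<exists>N::nat. \<exists>t. t 0 = T0 \<and> t N = T \<and> (\<forall>i\<le>N. t i \<in> top_simplices \<T>) \<and>
        (\<forall>i\<in>{1..N}. (t i \<inter> t (i - 1)) facet_of t i \<and>
                     (t i \<inter> t (i - 1)) facet_of t (i - 1) \<and>
                     T0 \<inter> T \<subseteq> t i \<inter> t (i - 1))))"

definition mesh_size :: "('n::{finite,linorder}) point set set \<Rightarrow> 'n point set \<Rightarrow> real"
  where "mesh_size \<T> S =
    (if aff_dim S = 0 then Min {diameter E | E. E \<in> \<T> \<and> aff_dim E = 1 \<and> S \<subseteq> E}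
     else diameter S)"

definition shape_measure :: "('n::{finite,linorder}) point set set \<Rightarrow> real"
  where "shape_measure \<T> =
    (SUP T\<in>{T\<in>\<T>. 1 \<le> aff_dim T}. diameter T ^ simplex_dim T / simplex_vol T)"

definition patch :: "('n::{finite,linorder}) point set set \<Rightarrow> 'n point set \<Rightarrow> 'n point set"
  where "patch \<T> S = \<Union> {T\<in>top_simplices \<T>. S \<subseteq> T}"

definition patch_star ::
    "('n::{finite,linorder}) point set set \<Rightarrow> 'n point set \<Rightarrow> 'n point set"
  where "patch_star \<T> S = \<Union> {T\<in>top_simplices \<T>. T \<inter> S \<noteq> {}}"


section \<open>Finite element spaces\<close>

text \<open>Polynomial degrees and form degrees are integers in this section, because negative ones occur in
  the definition of the degrees of freedom.\<close>

definition poly_forms :: "int \<Rightarrow> int \<Rightarrow> ('n::{finite,linorder}) dform set"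
  where "poly_forms r k = (if r < 0 \<or> k < 0 then {0} else
    {\<omega>. \<exists>c. (\<forall>\<alpha>. c \<alpha> \<in> covectors (nat k)) \<and>
      \<omega> = (\<lambda>x. \<Sum>\<alpha> | sum \<alpha> UNIV \<le> nat r. (\<Prod>i\<in>UNIV. (x $ i) ^ \<alpha> i) *\<^sub>R c \<alpha>)})"

definition koszul :: "('n::{finite,linorder}) dform \<Rightarrow> 'n dform"
  where "koszul \<omega> = (\<lambda>x. contract x (\<omega> x))"

definition trimmed_forms :: "int \<Rightarrow> int \<Rightarrow> ('n::{finite,linorder}) dform set"
  where "trimmed_forms r k = (if r \<le> 0 then {0} else
    {\<eta> + koszul \<zeta> | \<eta> \<zeta>. \<eta> \<in> poly_forms (r - 1) k \<and> \<zeta> \<in> poly_forms (r - 1) (k + 1)})"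

datatype fe_family = Full | Trimmed

definition fe_forms :: "fe_family \<Rightarrow> nat \<Rightarrow> nat \<Rightarrow> ('n::{finite,linorder}) dform set"
  where "fe_forms fam r k =
    (case fam of Full \<Rightarrow> poly_forms (int r) (int k) | Trimmed \<Rightarrow> trimmed_forms (int r) (int k))"

text \<open>The pullback of a form to \<open>S\<close>, as a field on \<open>S\<close> of alternating forms on the tangent space of
  \<open>S\<close>, extended by zero.\<close>

definition trace_form ::
    "'n point set \<Rightarrow> ('n::{finite,linorder}) dform \<Rightarrow> 'n point \<Rightarrow> 'n point list \<Rightarrow> real"
  where "trace_form S \<omega> =
    (\<lambda>x vs. if x \<in> S \<and> set vs \<subseteq> tangent S then eval_covec (\<omega> x) vs else 0)"

definition fe_bubbles :: "fe_family \<Rightarrow> nat \<Rightarrow> nat \<Rightarrow> ('n::{finite,linorder}) point set \<Rightarrow>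
    ('n point \<Rightarrow> 'n point list \<Rightarrow> real) set"
  where "fe_bubbles fam r k S = {trace_form S \<omega> | \<omega>. \<omega> \<in> fe_forms fam r k \<and>
    (\<forall>F. F face_of S \<and> F \<noteq> {} \<and> F \<noteq> S \<longrightarrow> trace_form F \<omega> = 0)}"

definition fe_index ::
    "fe_family \<Rightarrow> nat \<Rightarrow> nat \<Rightarrow> ('n::{finite,linorder}) point set \<Rightarrow> nat set"
  where "fe_index fam r k S = {1..dim (fe_bubbles fam r k S)}"

definition ae_eq_on ::
    "'n point set \<Rightarrow> ('n::{finite,linorder}) dform \<Rightarrow> 'n dform \<Rightarrow> bool"
  where "ae_eq_on U \<omega> \<eta> \<longleftrightarrow> (AE x in lebesgue_on U. \<omega> x = \<eta> x)"

definition fe_space :: "fe_family \<Rightarrow> nat \<Rightarrow> nat \<Rightarrow> 'n point set set \<Rightarrow> 'n point set \<Rightarrow>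
    ('n::{finite,linorder}) dform set"
  where "fe_space fam r k \<T> \<Omega> = {\<omega>\<in>Wpq_forms \<infinity> \<infinity> k \<Omega>.
    \<forall>T\<in>top_simplices \<T>. \<exists>\<eta>\<in>fe_forms fam r k. ae_eq_on T \<omega> \<eta>}"

text \<open>The polynomial form which agrees almost everywhere with \<open>\<omega>\<close> on the set \<open>U\<close> (which has nonempty
  interior). Traces and degrees of freedom on a lower-dimensional simplex contained in \<open>U\<close> are applied
  to this representative.\<close>

definition poly_rep :: "nat \<Rightarrow> 'n point set \<Rightarrow> ('n::{finite,linorder}) dform \<Rightarrow> 'n dform"
  where "poly_rep k U \<omega> = (THE \<eta>. (\<exists>s. \<eta> \<in> poly_forms s (int k)) \<and> ae_eq_on U \<omega> \<eta>)"

text \<open>The functional $\omega \mapsto \int_F \eta \wedge \mathrm{tr}_F\, \omega$, with domain the forms that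
  are continuous on \<open>F\<close>, extended by zero. The weight \<open>\<eta>\<close> is a form on $R^n$ of which only the pullback
  to \<open>F\<close> matters, as pullbacks commute with the exterior product.\<close>

definition dof :: "'n point set \<Rightarrow> ('n::{finite,linorder}) dform \<Rightarrow> 'n dform \<Rightarrow> real"
  where "dof F \<eta> = (\<lambda>\<omega>. if continuous_on F \<omega>
    then simplex_integral F (\<lambda>x. wedge (\<eta> x) (\<omega> x)) else 0)"

definition dof_space :: "fe_family \<Rightarrow> nat \<Rightarrow> nat \<Rightarrow> ('n::{finite,linorder}) point set \<Rightarrow>
    ('n dform \<Rightarrow> real) set"
  where "dof_space fam r k F = (let m = int (simplex_dim F) in
    case fam of
      Full \<Rightarrow> dof F ` trimmed_forms (int r + int k - m) (m - int k)
    | Trimmed \<Rightarrow> dof F ` poly_forms (int r + int k - m - 1) (m - int k))"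


section \<open>Biorthogonal bases, local projections and the interpolant\<close>

definition inv_exponent :: "ennreal \<Rightarrow> real"
  where "inv_exponent p = (if p = \<infinity> then 0 else 1 / enn2real p)"

text \<open>The trace on \<open>S\<close> of an element of the finite element space may be taken from any \<open>n\<close>-simplex
  \<open>T\<close> containing \<open>S\<close> and does not depend on \<open>T\<close>; the conditions below which involve such traces are
  stated for every \<open>T\<close>. The basis property of \<open>\<phi>\<close> is stated as spanning and linear independence
  up to null sets.\<close>

definition biorthogonal_system ::
    "real \<Rightarrow> ennreal \<Rightarrow> fe_family \<Rightarrow> nat \<Rightarrow> nat \<Rightarrow> 'n point set set \<Rightarrow> 'n point set \<Rightarrow>
     ('n point set \<Rightarrow> nat \<Rightarrow> ('n::{finite,linorder}) dform) \<Rightarrow>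
     ('n point set \<Rightarrow> nat \<Rightarrow> 'n dform \<Rightarrow> real) \<Rightarrow> bool"
  where "biorthogonal_system C p fam r k \<T> \<Omega> \<phi> \<phi>s \<longleftrightarrow>
    (\<forall>S\<in>\<T>. inj_on (\<phi>s S) (fe_index fam r k S) \<and>
      independent (\<phi>s S ` fe_index fam r k S) \<and>
      span (\<phi>s S ` fe_index fam r k S) = dof_space fam r k S) \<and>
    (\<forall>S\<in>\<T>. \<forall>i\<in>fe_index fam r k S. \<phi> S i \<in> fe_space fam r k \<T> \<Omega>) \<and>
    (\<forall>\<omega>\<in>fe_space fam r k \<T> \<Omega>. \<exists>c.
      ae_eq_on \<Omega> \<omega> (\<lambda>x. \<Sum>S\<in>\<T>. \<Sum>i\<in>fe_index fam r k S. c S i *\<^sub>R \<phi> S i x)) \<and>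
    (\<forall>c. ae_eq_on \<Omega> (\<lambda>x. \<Sum>S\<in>\<T>. \<Sum>i\<in>fe_index fam r k S. c S i *\<^sub>R \<phi> S i x) 0 \<longrightarrow>
      (\<forall>S\<in>\<T>. \<forall>i\<in>fe_index fam r k S. c S i = (0::real))) \<and>
    (\<forall>S\<in>\<T>. \<forall>i\<in>fe_index fam r k S. \<forall>S'\<in>\<T>. \<forall>j\<in>fe_index fam r k S'.
      \<forall>T\<in>top_simplices \<T>. S \<subseteq> T \<longrightarrow>
        \<phi>s S i (poly_rep k T (\<phi> S' j)) = (if (S, i) = (S', j) then 1 else 0)) \<and>
    (\<forall>S\<in>\<T>. \<forall>i\<in>fe_index fam r k S. \<forall>S'\<in>\<T>. \<not> S \<subseteq> S' \<longrightarrow>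
      (\<forall>T\<in>top_simplices \<T>. S' \<subseteq> T \<longrightarrow> trace_form S' (poly_rep k T (\<phi> S i)) = 0)) \<and>
    (\<forall>S\<in>\<T>. \<forall>i\<in>fe_index fam r k S. \<forall>T\<in>top_simplices \<T>. S \<subseteq> T \<longrightarrow>
      Lp_norm p T (\<phi> S i) \<le>
        ennreal (C * mesh_size \<T> S powr (real CARD('n) * inv_exponent p - real k)) \<and>
      (\<forall>\<omega>\<in>poly_forms (int r) (int k).
        Lp_norm p T (\<lambda>x. \<phi>s S i \<omega> *\<^sub>R \<phi> S i x) \<le> ennreal C * Lp_norm p T \<omega>))"

definition Lp_bounded_linear ::
    "ennreal \<Rightarrow> nat \<Rightarrow> 'n point set \<Rightarrow> (('n::{finite,linorder}) dform \<Rightarrow> 'n dform) \<Rightarrow> bool"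
  where "Lp_bounded_linear p k U A \<longleftrightarrow>
    (\<forall>\<omega>\<in>Lp_forms p k U. A \<omega> \<in> Lp_forms p k U) \<and>
    (\<forall>\<omega>\<in>Lp_forms p k U. \<forall>\<eta>\<in>Lp_forms p k U. \<forall>a b.
      ae_eq_on U (A (a *\<^sub>R \<omega> + b *\<^sub>R \<eta>)) (a *\<^sub>R A \<omega> + b *\<^sub>R A \<eta>)) \<and>
    (\<exists>B::real. \<forall>\<omega>\<in>Lp_forms p k U. Lp_norm p U (A \<omega>) \<le> ennreal B * Lp_norm p U \<omega>)"

definition patch_projections ::
    "real \<Rightarrow> ennreal \<Rightarrow> nat \<Rightarrow> nat \<Rightarrow> 'n point set set \<Rightarrow> 'n point set \<Rightarrow>
     ('n point set \<Rightarrow> ('n::{finite,linorder}) dform \<Rightarrow> 'n dform) \<Rightarrow> bool"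
  where "patch_projections C p r k \<T> \<Omega> P \<longleftrightarrow> (\<forall>S\<in>\<T>.
    Lp_bounded_linear p k \<Omega> (P S) \<and>
    (\<forall>\<omega>\<in>Lp_forms p k \<Omega>. ae_eq_on \<Omega> (P S (P S \<omega>)) (P S \<omega>)) \<and>
    (\<forall>\<omega>\<in>Lp_forms p k \<Omega>. \<exists>\<eta>\<in>poly_forms (int r) (int k).
      ae_eq_on \<Omega> (P S \<omega>) (\<lambda>x. if x \<in> patch \<T> S then \<eta> x else 0)) \<and>
    (\<forall>m\<in>{0..real r + 1}. \<forall>\<omega>\<in>sobolev_forms p m k \<Omega>.
      Lp_norm p (patch \<T> S) (\<omega> - P S \<omega>) \<le>
        ennreal (C * mesh_size \<T> S powr m) * sobolev_seminorm p m (interior (patch \<T> S)) \<omega>) \<and>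
    (\<forall>l\<in>{0..real r}. \<forall>\<omega>\<in>Wpq_forms p p k \<Omega>. ext_deriv \<Omega> \<omega> \<in> sobolev_forms p l (k + 1) \<Omega> \<longrightarrow>
      Lp_norm p (patch \<T> S) (ext_deriv \<Omega> \<omega> - ext_deriv (interior (patch \<T> S)) (P S \<omega>)) \<le>
        ennreal (C * mesh_size \<T> S powr l) *
        sobolev_seminorm p l (interior (patch \<T> S)) (ext_deriv \<Omega> \<omega>)))"

definition simplex_projections ::
    "real \<Rightarrow> ennreal \<Rightarrow> fe_family \<Rightarrow> nat \<Rightarrow> nat \<Rightarrow> 'n point set set \<Rightarrow>
     ('n point set \<Rightarrow> ('n::{finite,linorder}) dform \<Rightarrow> 'n dform) \<Rightarrow> bool"
  where "simplex_projections C p fam r k \<T> Q \<longleftrightarrow> (\<forall>T\<in>top_simplices \<T>.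
    Lp_bounded_linear p k T (Q T) \<and>
    (\<forall>\<omega>\<in>Lp_forms p k T. \<exists>\<eta>\<in>fe_forms fam r k. ae_eq_on T (Q T \<omega>) \<eta>) \<and>
    (\<forall>\<eta>\<in>fe_forms fam r k. ae_eq_on T (Q T \<eta>) \<eta>) \<and>
    (\<forall>\<omega>\<in>Lp_forms p k T. Lp_norm p T (\<omega> - Q T \<omega>) \<le>
      ennreal C * (INF \<psi>\<in>fe_forms fam r k. Lp_norm p T (\<omega> - \<psi>))) \<and>
    (\<forall>\<omega>\<in>Wpq_forms p p k (interior T).
      Lp_norm p T (ext_deriv (interior T) \<omega> - ext_deriv (interior T) (Q T \<omega>)) \<le>
      ennreal C * (INF \<psi>\<in>fe_forms fam r k.
        Lp_norm p T (ext_deriv (interior T) \<omega> - ext_deriv (interior T) \<psi>))))"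

definition clement_interpolant ::
    "fe_family \<Rightarrow> nat \<Rightarrow> nat \<Rightarrow> 'n point set set \<Rightarrow>
     ('n point set \<Rightarrow> nat \<Rightarrow> ('n::{finite,linorder}) dform) \<Rightarrow>
     ('n point set \<Rightarrow> nat \<Rightarrow> 'n dform \<Rightarrow> real) \<Rightarrow>
     ('n point set \<Rightarrow> 'n dform \<Rightarrow> 'n dform) \<Rightarrow> 'n dform \<Rightarrow> 'n dform"
  where "clement_interpolant fam r k \<T> \<phi> \<phi>s P \<omega> =
    (\<lambda>x. \<Sum>S\<in>\<T>. \<Sum>i\<in>fe_index fam r k S.
      \<phi>s S i (poly_rep k (patch \<T> S) (P S \<omega>)) *\<^sub>R \<phi> S i x)"

end

theory Submission
  imports Defs
begin

text \<open>On a top-dimensional simplex \<open>T\<close> only the basis forms attached to subsimplices of \<open>T\<close> survive, and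
  they reproduce the local space: the traces of the basis forms attached to a simplex \<open>F\<close> are linearly
  independent bubbles on \<open>F\<close>, as many as the dimension of the space of bubbles, so a local form all of
  whose degrees of freedom vanish has vanishing traces, by induction over the faces of \<open>T\<close>. This uses that
  a degree of freedom on \<open>F\<close> only depends on the trace on \<open>F\<close>, which follows from the antiderivation
  property of the contraction.

  The approximation property of $P_S$ with $m = 0$ is a stability estimate; with the bound on
  $\phi^*_{S,i}(\cdot)\phi_{S,i}$ it gives the first inequality. For the second one, let $\psi$ be the
  polynomial form $\Pi_T \omega$. By local reproduction
  $\psi - I\omega = \sum_{S,i} \phi^*_{S,i}(\psi - P_S \omega)\, \phi_{S,i}$ on \<open>T\<close>, and
  $\psi - P_S\omega$ is bounded by $\omega - \psi$ and $\omega - P_S\omega$.\<close>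


section \<open>Contraction and exterior product\<close>

text \<open>An L^p form has no trace on a lower-dimensional simplex, so on \<open>T\<close> every
  form is replaced by the polynomial form that it equals almost everywhere. The identity theorem
  makes this representative unique, and the algebra takes place on representatives. Unisolvence of
  the degrees of freedom is not assumed but read off from biorthogonality: a functional on
  \<open>F\<close> that sees only traces can be applied to a vanishing combination of traces, and
  there it isolates each coefficient. From exterior algebra this asks only that a wedge product
  pulls back to zero as soon as its second factor does. The final constant has to be chosen before
  the triangulation, the form degree and the family are known. It combines a bound, in terms of n
  and \<open>r\<close> alone, for the number of pairs \<open>(S, i)\<close> with S in T, with the
  constants \<open>C_A\<close> and \<open>C_BH\<close>, taken in absolute value because they are
  arbitrary reals.\<close>

lemma bounded_bilinear_contract: "bounded_bilinear (contract :: ('n::{finite,linorder}) point \<Rightarrow> _)"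
  unfolding bilinear_conv_bounded_bilinear [symmetric] bilinear_def
  by (auto intro!: linearI simp: contract_def vec_eq_iff algebra_simps sum.distrib
      sum_distrib_left scaleR_vec_def)

lemma bounded_bilinear_wedge: "bounded_bilinear (wedge :: ('n::{finite,linorder}) covec \<Rightarrow> _)"
  unfolding bilinear_conv_bounded_bilinear [symmetric] bilinear_def
  by (auto intro!: linearI simp: wedge_def vec_eq_iff algebra_simps sum.distrib
      sum_distrib_left scaleR_vec_def)

interpretation contract: bounded_bilinear "contract :: ('n::{finite,linorder}) point \<Rightarrow> _"
  by (rule bounded_bilinear_contract)

interpretation wedge: bounded_bilinear "wedge :: ('n::{finite,linorder}) covec \<Rightarrow> _"
  by (rule bounded_bilinear_wedge)

text \<open>The automorphism that multiplies k-covectors by (-1)^k. It expresses the antiderivation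
  rule for covectors of mixed degree, so that no degree has to be tracked through
  inductions.\<close>

definition grade_involution :: "('n::{finite,linorder}) covec \<Rightarrow> 'n covec"
  where "grade_involution u = (\<chi> I. (- 1) ^ card I * u $ I)"

text \<open>The parity of this number is the sign of the permutation that sorts the increasing list
  of \<open>I\<close> followed by that of \<open>K\<close>.\<close>

definition inversions :: "('n::{finite,linorder}) set \<Rightarrow> 'n set \<Rightarrow> nat"
  where "inversions I K = card {(i, j). i \<in> I \<and> j \<in> K \<and> j < i}"

lemma inversions_eq_Sigma:
  "{(i, j). i \<in> I \<and> j \<in> K \<and> j < i} = Sigma I (\<lambda>i. {j\<in>K. j < i})"
  by auto

lemma inversions_sum: "inversions I K = (\<Sum>i\<in>I. card {j\<in>K. j < i})"
  unfolding inversions_def inversions_eq_Sigma by (simp add: card_SigmaI)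

lemma inversions_sum': "inversions I K = (\<Sum>j\<in>K. card {i\<in>I. j < i})"
proof -
  have "inversions I K = card (Sigma K (\<lambda>j. {i\<in>I. j < i}))"
    unfolding inversions_def
    by (rule bij_betw_same_card [of prod.swap]) (auto simp: bij_betw_def inj_on_def image_iff)
  then show ?thesis
    by (simp add: card_SigmaI)
qed

lemma inversions_insert_left:
  "i \<notin> I \<Longrightarrow> inversions (insert i I) K = inversions I K + card {j\<in>K. j < i}"
  by (simp add: inversions_sum)

lemma inversions_insert_right:
  "i \<notin> K \<Longrightarrow> inversions I (insert i K) = inversions I K + card {j\<in>I. i < j}"
  by (simp add: inversions_sum')

lemma card_less_plus_greater:
  fixes I :: "('n::{finite,linorder}) set"
  assumes "i \<notin> I"
  shows "card {j\<in>I. j < i} + card {j\<in>I. i < j} = card I"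
proof -
  have "{j\<in>I. j < i} \<union> {j\<in>I. i < j} = I"
    using assms by auto (metis neqE)
  moreover have "card ({j\<in>I. j < i} \<union> {j\<in>I. i < j}) = card {j\<in>I. j < i} + card {j\<in>I. i < j}"
    by (rule card_Un_disjoint) auto
  ultimately show ?thesis by simp
qed

lemma card_less_split:
  fixes I J :: "('n::{finite,linorder}) set"
  assumes "I \<subseteq> J"
  shows "card {j\<in>J. j < i} = card {j\<in>I. j < i} + card {j\<in>J - I. j < i}"
proof -
  have "{j\<in>J. j < i} = {j\<in>I. j < i} \<union> {j\<in>J - I. j < i}"
    using assms by auto
  moreover have "card ({j\<in>I. j < i} \<union> {j\<in>J - I. j < i}) = card {j\<in>I. j < i} + card {j\<in>J - I. j < i}"
    by (rule card_Un_disjoint) auto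
  ultimately show ?thesis by simp
qed

lemma wedge_nth:
  "wedge u v $ K = (\<Sum>I\<in>Pow K. (- 1) ^ inversions I (K - I) * (u $ I) * (v $ (K - I)))"
  by (simp add: wedge_def inversions_def)

lemma contract_axis_nth:
  "contract (axis i 1) u $ J = (if i \<in> J then 0 else (- 1) ^ card {j\<in>J. j < i} * u $ insert i J)"
proof -
  have "contract (axis i 1) u $ J =
      (\<Sum>i'\<in>- J. if i' = i then (- 1) ^ card {j\<in>J. j < i} * u $ insert i J else 0)"
    unfolding contract_def vec_lambda_beta by (intro sum.cong) (auto simp: axis_def)
  also have "\<dots> = (if i \<in> J then 0 else (- 1) ^ card {j\<in>J. j < i} * u $ insert i J)"
    by (subst sum.delta) auto
  finally show ?thesis .
qed

lemma sum_Pow_insert: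
  fixes J :: "('n::finite) set"
  assumes "i \<notin> J"
  shows "(\<Sum>I\<in>Pow (insert i J). f I) = (\<Sum>I\<in>Pow J. f I) + (\<Sum>I\<in>Pow J. f (insert i I))"
proof -
  have "inj_on (insert i) (Pow J)"
    using assms by (auto simp: inj_on_def)
  moreover have "Pow J \<inter> insert i ` Pow J = {}"
    using assms by auto
  ultimately show ?thesis
    unfolding Pow_insert by (subst sum.union_disjoint) (simp_all add: sum.reindex)
qed

lemma minus_one_power_eqI: "even (m + n) \<Longrightarrow> (- 1 :: real) ^ m = (- 1) ^ n"
  by (metis even_add neg_one_even_power neg_one_odd_power)

lemma minus_one_power_cancel:
  assumes "odd (m + n)"
  shows "(- 1 :: real) ^ m + (- 1) ^ n = 0"
  using assms by (cases "even m") (auto simp: minus_one_power_iff)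

text \<open>Coefficients are compared at \<open>J\<close>. If \<open>i\<close> is not in
  \<open>J\<close>, the subsets of \<open>insert i J\<close> split into those without
  \<open>i\<close> and those with \<open>i\<close>, which produce the two products. If
  \<open>i\<close> is in \<open>J\<close>, the left side vanishes and the two products on the right
  cancel term by term.\<close>

lemma contract_axis_wedge:
  fixes u v :: "('n::{finite,linorder}) covec"
  shows "contract (axis i 1) (wedge u v) =
    wedge (contract (axis i 1) u) v + wedge (grade_involution u) (contract (axis i 1) v)"
proof (subst vec_eq_iff, rule allI)
  fix J :: "'n set"
  let ?m = "\<lambda>A. card {j\<in>A. j < i}"
  show "contract (axis i 1) (wedge u v) $ J =
    (wedge (contract (axis i 1) u) v + wedge (grade_involution u) (contract (axis i 1) v)) $ J"
  proof (cases "i \<in> J")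
    case False
    have "contract (axis i 1) (wedge u v) $ J = (-1) ^ ?m J *
        ((\<Sum>I\<in>Pow J. (-1) ^ inversions I (insert i J - I) * u $ I * v $ (insert i J - I)) +
         (\<Sum>I\<in>Pow J. (-1) ^ inversions (insert i I) (J - I) * u $ insert i I * v $ (J - I)))"
      using False by (simp add: contract_axis_nth wedge_nth sum_Pow_insert)
    also have "\<dots> = (\<Sum>I\<in>Pow J. (-1) ^ (?m J + inversions I (insert i (J - I))) * u $ I * v $ insert i (J - I)) +
         (\<Sum>I\<in>Pow J. (-1) ^ (?m J + inversions (insert i I) (J - I)) * u $ insert i I * v $ (J - I))"
      using False by (auto simp: distrib_left sum_distrib_left power_add mult.assoc insert_Diff_if intro!: arg_cong2[where f="(+)"] sum.cong)
    also have "(\<Sum>I\<in>Pow J. (-1) ^ (?m J + inversions I (insert i (J - I))) * u $ I * v $ insert i (J - I)) =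
       wedge (grade_involution u) (contract (axis i 1) v) $ J"
      unfolding wedge_nth
    proof (rule sum.cong [OF refl])
      fix I assume "I \<in> Pow J"
      then have I: "I \<subseteq> J" "i \<notin> I" using False by auto
      \<comment> \<open>Inserting \<open>i\<close> on the right adds the elements of
        \<open>I\<close> above \<open>i\<close>, and \<open>?m J\<close> contributes those below.
        Together they make \<open>card I\<close>, the sign of the grade involution.\<close>
      have "(-1::real) ^ (?m J + inversions I (insert i (J - I))) = (-1) ^ (inversions I (J - I) + card I + ?m (J - I))"
        using I False card_less_split [OF I(1), of i] card_less_plus_greater [OF I(2)]
          inversions_insert_right [of i "J - I" I]
        by (intro minus_one_power_eqI) (simp, presburger)
      then show "(-1) ^ (?m J + inversions I (insert i (J - I))) * u $ I * v $ insert i (J - I) =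
         (-1) ^ inversions I (J - I) * grade_involution u $ I * contract (axis i 1) v $ (J - I)"
        using False by (simp add: grade_involution_def contract_axis_nth power_add)
    qed
    also have "(\<Sum>I\<in>Pow J. (-1) ^ (?m J + inversions (insert i I) (J - I)) * u $ insert i I * v $ (J - I)) =
       wedge (contract (axis i 1) u) v $ J"
      unfolding wedge_nth
    proof (rule sum.cong [OF refl])
      fix I assume "I \<in> Pow J"
      then have I: "I \<subseteq> J" "i \<notin> I" using False by auto
      have "(-1::real) ^ (?m J + inversions (insert i I) (J - I)) = (-1) ^ (inversions I (J - I) + ?m I)"
        using card_less_split [OF I(1), of i] inversions_insert_left [OF I(2), of "J - I"]
        by (intro minus_one_power_eqI) presburger
      then show "(-1) ^ (?m J + inversions (insert i I) (J - I)) * u $ insert i I * v $ (J - I) =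
         (-1) ^ inversions I (J - I) * contract (axis i 1) u $ I * v $ (J - I)"
        using I by (simp add: contract_axis_nth power_add)
    qed
    finally show ?thesis by simp
  next
    case True
    then obtain J' where J: "J = insert i J'" "i \<notin> J'"
      by (metis insertI1 mk_disjoint_insert)
    have "wedge (contract (axis i 1) u) v $ J =
      (\<Sum>I\<in>Pow J'. (-1) ^ (inversions I (insert i (J' - I)) + ?m I) * u $ insert i I * v $ insert i (J' - I))"
      unfolding wedge_nth J(1) sum_Pow_insert [OF J(2)]
      using J(2) by (auto simp: contract_axis_nth insert_Diff_if power_add subset_iff intro!: sum.cong)
    moreover have "wedge (grade_involution u) (contract (axis i 1) v) $ J =
      (\<Sum>I\<in>Pow J'. (-1) ^ (inversions (insert i I) (J' - I) + card (insert i I) + ?m (J' - I)) *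
         u $ insert i I * v $ insert i (J' - I))"
      unfolding wedge_nth J(1) sum_Pow_insert [OF J(2)]
    proof (subst sum.neutral)
      show "\<forall>I\<in>Pow J'. (-1) ^ inversions I (insert i J' - I) * grade_involution u $ I *
          contract (axis i 1) v $ (insert i J' - I) = 0"
        using J(2) by (auto simp: contract_axis_nth)
      have *: "insert i J' - insert i I = J' - I" for I
        using J(2) by auto
      show "0 + (\<Sum>I\<in>Pow J'. (-1) ^ inversions (insert i I) (insert i J' - insert i I) *
          grade_involution u $ insert i I * contract (axis i 1) v $ (insert i J' - insert i I)) =
        (\<Sum>I\<in>Pow J'. (-1) ^ (inversions (insert i I) (J' - I) + card (insert i I) + ?m (J' - I)) *
         u $ insert i I * v $ insert i (J' - I))"
        unfolding * using J(2) by (simp add: contract_axis_nth grade_involution_def power_add mult_ac)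
    qed
    \<comment> \<open>Up to even numbers the two exponents differ by 1, which comes from
      \<open>card (insert i I)\<close>, so the signs are opposite.\<close>
    moreover have "(-1::real) ^ (inversions I (insert i (J' - I)) + ?m I) +
        (-1) ^ (inversions (insert i I) (J' - I) + card (insert i I) + ?m (J' - I)) = 0"
      if "I \<in> Pow J'" for I
    proof -
      have i: "i \<notin> I" "i \<notin> J' - I" using that J by auto
      show ?thesis
        using card_less_plus_greater [OF i(1)]
          inversions_insert_left [OF i(1), of "J' - I"] inversions_insert_right [OF i(2), of I]
          card_insert_disjoint [OF finite i(1)]
        by (intro minus_one_power_cancel) presburger
    qed
    ultimately have "(wedge (contract (axis i 1) u) v + wedge (grade_involution u) (contract (axis i 1) v)) $ J = 0"
      by (simp add: sum.distrib [symmetric] distrib_right [symmetric])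
    then show ?thesis
      using True by (simp add: contract_axis_nth)
  qed
qed

lemma contract_eq_sum_axis:
  "contract x u = (\<Sum>i\<in>UNIV. x $ i *\<^sub>R contract (axis i 1) u)"
proof -
  have x: "x = (\<Sum>i\<in>UNIV. x $ i *\<^sub>R axis i 1)"
    by (simp add: vec_eq_iff axis_def if_distrib cong: if_cong)
  show ?thesis
    by (subst x) (simp only: contract.sum_left contract.scaleR_left)
qed

lemma contract_wedge:
  fixes u v :: "('n::{finite,linorder}) covec"
  shows "contract x (wedge u v) =
    wedge (contract x u) v + wedge (grade_involution u) (contract x v)"
  unfolding contract_eq_sum_axis [of x]
  by (simp only: contract_axis_wedge scaleR_add_right sum.distrib wedge.sum_left wedge.scaleR_left
      wedge.sum_right wedge.scaleR_right)

section \<open>Evaluation of covectors on lists of vectors\<close>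

lemma linear_eval_covec: "linear (\<lambda>u. eval_covec u vs)"
proof (induction vs)
  case (Cons v vs)
  then show ?case
    by (auto simp: linear_iff contract.add_right contract.scaleR_right)
qed (simp add: linear_iff)

text \<open>Contracting the product with a vector of \<open>W\<close> leaves two products whose
  second factors, \<open>v\<close> and its contraction, still vanish on \<open>W\<close>. The
  induction therefore generalises over both factors. This replaces the rule that pullbacks commute
  with exterior products.\<close>

lemma eval_covec_wedge_eq_0:
  assumes "\<And>ws. set ws \<subseteq> W \<Longrightarrow> eval_covec v ws = 0" "set vs \<subseteq> W"
  shows "eval_covec (wedge u v) vs = 0"
  using assms
proof (induction vs arbitrary: u v)
  case Nil
  then show ?case using Nil(1)[of "[]"] by (simp add: wedge_nth)
next
  case (Cons x vs)
  have "eval_covec (contract x v) ws = 0" if "set ws \<subseteq> W" for ws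
    using Cons.prems(1) [of "x # ws"] Cons.prems(2) that by simp
  then have "eval_covec (wedge (grade_involution u) (contract x v)) vs = 0"
    using Cons by simp
  moreover have "eval_covec (wedge (contract x u) v) vs = 0"
    using Cons by simp
  ultimately show ?case
    by (simp add: contract_wedge linear_add [OF linear_eval_covec])
qed

text \<open>Contraction with axis vectors strips off one index at a time, up to sign, and so reaches
  every coefficient.\<close>

lemma eval_covec_eq_0_iff: "(\<forall>vs. eval_covec u vs = 0) \<longleftrightarrow> u = 0"
proof
  assume u: "\<forall>vs. eval_covec u vs = 0"
  have "u $ I = 0" for I
  proof -
    have "finite I" by simp
    then show ?thesis
      using u
    proof (induction I arbitrary: u rule: finite_induct)
      case empty
      then show ?case by (metis eval_covec.simps(1))
    next
      case (insert i I)
      have "\<forall>vs. eval_covec (contract (axis i 1) u) vs = 0"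
        using insert.prems by (metis eval_covec.simps(2))
      from insert.IH [OF this] show ?case
        using insert.hyps by (simp add: contract_axis_nth)
    qed
  qed
  then show "u = 0" by (simp add: vec_eq_iff)
qed (simp add: linear_0 [OF linear_eval_covec])

lemma contract_covectors: "u \<in> covectors (Suc k) \<Longrightarrow> contract x u \<in> covectors k"
  unfolding covectors_def contract_def
  by (auto elim!: sum.not_neutral_contains_not_neutral)

lemma subspace_covectors: "subspace (covectors k)"
  by (auto simp: subspace_def covectors_def) (metis add_0)


section \<open>Polynomial forms\<close>

definition monomial :: "('n::finite \<Rightarrow> nat) \<Rightarrow> 'n point \<Rightarrow> real"
  where "monomial \<alpha> x = (\<Prod>i\<in>UNIV. (x $ i) ^ \<alpha> i)"

lemma finite_multi_indices: "finite {\<alpha> :: 'n::finite \<Rightarrow> nat. sum \<alpha> UNIV \<le> r}"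
proof -
  have "{\<alpha> :: 'n \<Rightarrow> nat. sum \<alpha> UNIV \<le> r} \<subseteq> PiE UNIV (\<lambda>_. {..r})"
  proof
    fix \<alpha> :: "'n \<Rightarrow> nat" assume "\<alpha> \<in> {\<alpha>. sum \<alpha> UNIV \<le> r}"
    then have "\<alpha> i \<le> r" for i
      using member_le_sum [of i UNIV \<alpha>] by simp
    then show "\<alpha> \<in> PiE UNIV (\<lambda>_. {..r})" by (simp add: PiE_iff)
  qed
  moreover have "finite (PiE (UNIV :: 'n set) (\<lambda>_. {..r}))"
    by (intro finite_PiE) auto
  ultimately show ?thesis by (rule finite_subset)
qed

lemma sum_fun_apply: "(\<Sum>i\<in>I. f i) x = (\<Sum>i\<in>I. f i x)"
  by (induction I rule: infinite_finite_induct) auto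

lemma poly_forms_nat:
  "poly_forms (int r) (int k) = {\<omega>. \<exists>c. (\<forall>\<alpha>. c \<alpha> \<in> covectors k) \<and>
      \<omega> = (\<lambda>x. \<Sum>\<alpha> | sum \<alpha> UNIV \<le> r. monomial \<alpha> x *\<^sub>R c \<alpha>)}"
  by (simp add: poly_forms_def monomial_def)

text \<open>Degrees are integers, and negative ones stand for the zero space. This rule isolates the
  convention, so that later arguments work with natural numbers.\<close>

lemma poly_forms_cases:
  assumes "\<omega> \<in> poly_forms r k"
  obtains "\<omega> = 0" | r' k' where "r = int r'" "k = int k'" "\<omega> \<in> poly_forms (int r') (int k')"
  using assms by (metis empty_iff insert_iff not_less poly_forms_def zero_le_imp_eq_int)

lemma subspace_poly_forms: "subspace (poly_forms r k :: ('n::{finite,linorder}) dform set)"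
proof (cases "r < 0 \<or> k < 0")
  case True
  then show ?thesis by (simp add: poly_forms_def)
next
  case False
  then obtain r' k' where rk: "r = int r'" "k = int k'"
    by (meson not_less zero_le_imp_eq_int)
  show ?thesis
    unfolding rk
  proof (rule subspaceI)
    show "0 \<in> (poly_forms (int r') (int k') :: 'n dform set)"
      unfolding poly_forms_nat
      by (auto intro!: exI[of _ "\<lambda>_. 0"] simp: subspace_0 [OF subspace_covectors] zero_fun_def)
  next
    fix \<omega> \<eta> :: "'n dform"
    assume "\<omega> \<in> poly_forms (int r') (int k')" "\<eta> \<in> poly_forms (int r') (int k')"
    then obtain c d where
      "\<forall>\<alpha>. c \<alpha> \<in> covectors k'" "\<omega> = (\<lambda>x. \<Sum>\<alpha> | sum \<alpha> UNIV \<le> r'. monomial \<alpha> x *\<^sub>R c \<alpha>)"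
      "\<forall>\<alpha>. d \<alpha> \<in> covectors k'" "\<eta> = (\<lambda>x. \<Sum>\<alpha> | sum \<alpha> UNIV \<le> r'. monomial \<alpha> x *\<^sub>R d \<alpha>)"
      unfolding poly_forms_nat by blast
    then show "\<omega> + \<eta> \<in> poly_forms (int r') (int k')"
      unfolding poly_forms_nat
      by (auto intro!: exI[of _ "\<lambda>\<alpha>. c \<alpha> + d \<alpha>"] subspace_add [OF subspace_covectors]
          simp: fun_eq_iff sum.distrib scaleR_add_right)
  next
    fix a and \<omega> :: "'n dform"
    assume "\<omega> \<in> poly_forms (int r') (int k')"
    then obtain c where
      "\<forall>\<alpha>. c \<alpha> \<in> covectors k'" "\<omega> = (\<lambda>x. \<Sum>\<alpha> | sum \<alpha> UNIV \<le> r'. monomial \<alpha> x *\<^sub>R c \<alpha>)"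
      unfolding poly_forms_nat by blast
    then show "a *\<^sub>R \<omega> \<in> poly_forms (int r') (int k')"
      unfolding poly_forms_nat
      by (auto intro!: exI[of _ "\<lambda>\<alpha>. a *\<^sub>R c \<alpha>"] subspace_scale [OF subspace_covectors]
          simp: fun_eq_iff scaleR_fun_def scaleR_sum_right mult.commute)
  qed
qed

lemma monomial_in_poly_forms:
  assumes "sum \<alpha> UNIV \<le> r" "c \<in> covectors k"
  shows "(\<lambda>x :: ('n::{finite,linorder}) point. monomial \<alpha> x *\<^sub>R c) \<in> poly_forms (int r) (int k)"
proof -
  have "(\<Sum>\<beta> | sum \<beta> UNIV \<le> r. monomial \<beta> x *\<^sub>R (if \<beta> = \<alpha> then c else 0)) = monomial \<alpha> x *\<^sub>R c"
    for x :: "'n point"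
    using assms(1) finite_multi_indices[where 'n='n, of r] by (simp add: if_distrib cong: if_cong)
  then show ?thesis
    unfolding poly_forms_nat using assms(2)
    by (auto intro!: exI[of _ "\<lambda>\<beta>. if \<beta> = \<alpha> then c else 0"] simp: subspace_0 [OF subspace_covectors])
qed

lemma sum_in_poly_forms:
  assumes "\<And>i. i \<in> I \<Longrightarrow> f i \<in> poly_forms r k"
  shows "(\<lambda>x. \<Sum>i\<in>I. f i x) \<in> poly_forms r k"
proof -
  have "(\<lambda>x. \<Sum>i\<in>I. f i x) = (\<Sum>i\<in>I. f i)"
    by (simp add: fun_eq_iff sum_fun_apply)
  then show ?thesis
    using subspace_sum [OF subspace_poly_forms, of I f] assms by metis
qed

lemma monomial_times_coordinate:
  "monomial \<alpha> x * x $ i = monomial (\<alpha>(i := Suc (\<alpha> i))) x"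
proof -
  have "(\<Prod>j\<in>UNIV - {i}. (x $ j) ^ (\<alpha>(i := Suc (\<alpha> i))) j) = (\<Prod>j\<in>UNIV - {i}. (x $ j) ^ \<alpha> j)"
    by (rule prod.cong) auto
  then show ?thesis
    using prod.remove [of UNIV i "\<lambda>j. (x $ j) ^ (\<alpha>(i := Suc (\<alpha> i))) j"]
      prod.remove [of UNIV i "\<lambda>j. (x $ j) ^ \<alpha> j"]
    by (simp add: monomial_def del: fun_upd_apply) (simp add: mult_ac)
qed

lemma poly_forms_mono:
  assumes "r \<le> s"
  shows "poly_forms r k \<subseteq> (poly_forms s k :: ('n::{finite,linorder}) dform set)"
proof
  fix \<omega> :: "'n dform"
  assume "\<omega> \<in> poly_forms r k"
  then show "\<omega> \<in> poly_forms s k"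
  proof (cases rule: poly_forms_cases)
    case (2 r' k')
    then obtain c where c: "\<And>\<alpha>. c \<alpha> \<in> covectors k'"
      "\<omega> = (\<lambda>x. \<Sum>\<alpha> | sum \<alpha> UNIV \<le> r'. monomial \<alpha> x *\<^sub>R c \<alpha>)"
      unfolding poly_forms_nat by blast
    obtain s' where s': "s = int s'" "r' \<le> s'"
      using 2(1) assms by (metis nat_int nat_le_iff of_nat_0_le_iff order_trans zero_le_imp_eq_int)
    show ?thesis
      unfolding c(2) 2(2) s' using c(1) s'(2)
      by (intro sum_in_poly_forms monomial_in_poly_forms) auto
  qed (simp add: subspace_0 [OF subspace_poly_forms])
qed

lemma sum_fun_upd_Suc: "sum (\<alpha>(i := Suc (\<alpha> i))) UNIV = Suc (sum \<alpha> (UNIV :: 'n::finite set))"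
proof -
  have "sum (\<alpha>(i := Suc (\<alpha> i))) (UNIV - {i}) = sum \<alpha> (UNIV - {i})"
    by (rule sum.cong) auto
  then show ?thesis
    using sum.remove [of UNIV i \<alpha>] sum.remove [of UNIV i "\<alpha>(i := Suc (\<alpha> i))"] by simp
qed

section \<open>The Koszul operator and trimmed forms\<close>

lemma koszul_poly_forms:
  assumes "\<zeta> \<in> poly_forms r (int k + 1)"
  shows "koszul \<zeta> \<in> (poly_forms (r + 1) (int k) :: ('n::{finite,linorder}) dform set)"
  using assms
proof (cases rule: poly_forms_cases)
  case (2 r' k')
  from 2(2) have k': "k' = Suc k" by linarith
  from 2 obtain c where c: "\<And>\<alpha>. c \<alpha> \<in> covectors k'"
      "\<zeta> = (\<lambda>x. \<Sum>\<alpha> | sum \<alpha> UNIV \<le> r'. monomial \<alpha> x *\<^sub>R c \<alpha>)"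
      unfolding poly_forms_nat by blast
  have "koszul \<zeta> = (\<lambda>x. \<Sum>\<alpha> | sum \<alpha> UNIV \<le> r'. \<Sum>i\<in>UNIV.
      monomial (\<alpha>(i := Suc (\<alpha> i))) x *\<^sub>R contract (axis i 1) (c \<alpha>))"
  proof
    fix y
    have "koszul \<zeta> y = (\<Sum>\<alpha> | sum \<alpha> UNIV \<le> r'. monomial \<alpha> y *\<^sub>R contract y (c \<alpha>))"
      unfolding koszul_def c(2) by (simp add: contract.sum_right contract.scaleR_right)
    also have "\<dots> = (\<Sum>\<alpha> | sum \<alpha> UNIV \<le> r'. monomial \<alpha> y *\<^sub>R (\<Sum>i\<in>UNIV. y $ i *\<^sub>R contract (axis i 1) (c \<alpha>)))"
      by (subst contract_eq_sum_axis) (rule refl)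
    finally show "koszul \<zeta> y = (\<Sum>\<alpha> | sum \<alpha> UNIV \<le> r'. \<Sum>i\<in>UNIV.
        monomial (\<alpha>(i := Suc (\<alpha> i))) y *\<^sub>R contract (axis i 1) (c \<alpha>))"
      by (simp add: scaleR_sum_right monomial_times_coordinate del: fun_upd_apply)
  qed
  moreover have "\<dots> \<in> poly_forms (int (Suc r')) (int k)"
    using c(1) k'
    by (intro sum_in_poly_forms monomial_in_poly_forms contract_covectors)
      (auto simp: sum_fun_upd_Suc simp del: fun_upd_apply)
  ultimately show ?thesis
    using 2 by (simp add: add.commute)
next
  case 1
  then have "koszul \<zeta> = 0"
    by (simp add: koszul_def fun_eq_iff contract.zero_right)
  then show ?thesis
    by (simp add: subspace_0 [OF subspace_poly_forms])
qed

lemma linear_koszul: "linear koszul"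
  by (auto simp: linear_iff koszul_def fun_eq_iff contract.add_right contract.scaleR_right scaleR_fun_def)

lemma subspace_trimmed_forms:
  "subspace (trimmed_forms r k :: ('n::{finite,linorder}) dform set)"
proof (cases "r \<le> 0")
  case False
  then have "(trimmed_forms r k :: 'n dform set) = {\<eta> + \<zeta> | \<eta> \<zeta>. \<eta> \<in> poly_forms (r - 1) k \<and> \<zeta> \<in> koszul ` poly_forms (r - 1) (k + 1)}"
    by (auto simp: trimmed_forms_def)
  then show ?thesis
    by (simp only:) (intro subspace_sums subspace_poly_forms linear_subspace_image linear_koszul)
qed (simp add: trimmed_forms_def)

lemma subspace_fe_forms: "subspace (fe_forms fam r k)"
  by (cases fam) (auto simp: fe_forms_def subspace_poly_forms subspace_trimmed_forms)

text \<open>Through this inclusion the representatives, and the bounds assumed for full polynomial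
  forms, serve both families alike.\<close>

lemma fe_forms_subset_poly_forms: "fe_forms fam r k \<subseteq> poly_forms (int r) (int k)"
proof (cases fam)
  case Trimmed
  show ?thesis
  proof
    fix \<omega> :: "'a dform" assume "\<omega> \<in> fe_forms fam r k"
    then have \<omega>: "\<omega> \<in> trimmed_forms (int r) (int k)"
      by (simp add: fe_forms_def Trimmed)
    show "\<omega> \<in> poly_forms (int r) (int k)"
    proof (cases "int r \<le> 0")
      case True
      then show ?thesis using \<omega> by (simp add: trimmed_forms_def subspace_0 [OF subspace_poly_forms])
    next
      case False
      then obtain \<eta> \<zeta> where *: "\<omega> = \<eta> + koszul \<zeta>" "\<eta> \<in> poly_forms (int r - 1) (int k)"
        "\<zeta> \<in> poly_forms (int r - 1) (int k + 1)"
        using \<omega> by (auto simp: trimmed_forms_def)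
      have "\<eta> \<in> poly_forms (int r) (int k)"
        using poly_forms_mono [of "int r - 1" "int r" "int k"] *(2) by auto
      moreover have "koszul \<zeta> \<in> poly_forms (int r) (int k)"
        using koszul_poly_forms [OF *(3)] by simp
      ultimately show ?thesis
        unfolding *(1) by (rule subspace_add [OF subspace_poly_forms])
    qed
  qed
qed (simp add: fe_forms_def)

lemma real_polynomial_function_poly_forms:
  assumes "\<omega> \<in> poly_forms r k"
  shows "real_polynomial_function (\<lambda>x. \<omega> x $ I)"
  using assms
proof (cases rule: poly_forms_cases)
  case (2 r' k')
  then obtain c where "\<omega> = (\<lambda>x. \<Sum>\<alpha> | sum \<alpha> UNIV \<le> r'. monomial \<alpha> x *\<^sub>R c \<alpha>)"
    unfolding poly_forms_nat by blast
  then have "(\<lambda>x. \<omega> x $ I) = (\<lambda>x. \<Sum>\<alpha> | sum \<alpha> UNIV \<le> r'. (\<Prod>i\<in>UNIV. x $ i ^ \<alpha> i) * c \<alpha> $ I)"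
    by (simp add: monomial_def)
  moreover have "real_polynomial_function \<dots>"
    by (intro real_polynomial_function_sum real_polynomial_function.intros(4) real_polynomial_function_prod
        real_polynomial_function_power real_polynomial_function.intros(2) finite_multi_indices)
      (simp_all add: real_polynomial_function.intros(1) bounded_linear_vec_nth)
  ultimately show ?thesis by simp
qed (simp add: real_polynomial_function.intros)

lemma continuous_on_poly_forms:
  assumes "\<omega> \<in> poly_forms r k"
  shows "continuous_on A \<omega>"
proof -
  have "continuous_on A (\<lambda>x. \<chi> I. \<omega> x $ I)"
    by (intro continuous_on_vec_lambda continuous_at_imp_continuous_on ballI
        continuous_real_polymonial_function real_polynomial_function_poly_forms [OF assms])
  then show ?thesis by simp
qed

lemma continuous_on_koszul:
  assumes "continuous_on A \<omega>"
  shows "continuous_on A (koszul \<omega>)"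
  unfolding koszul_def by (intro contract.continuous_on continuous_on_id assms)

text \<open>The weights of the degrees of freedom have form degree \<open>m - k\<close>, which may
  be negative; continuity is therefore taken from the two summands and not from an inclusion into
  polynomial forms.\<close>

lemma continuous_on_trimmed_forms:
  assumes "\<omega> \<in> trimmed_forms r k"
  shows "continuous_on A \<omega>"
proof (cases "r \<le> 0")
  case False
  then obtain \<eta> \<zeta> where \<omega>: "\<omega> = (\<lambda>x. \<eta> x + koszul \<zeta> x)"
    and *: "\<eta> \<in> poly_forms (r - 1) k" "\<zeta> \<in> poly_forms (r - 1) (k + 1)"
    using assms by (auto simp: trimmed_forms_def plus_fun_def)
  show ?thesis
    unfolding \<omega> by (rule continuous_on_add [OF continuous_on_poly_forms [OF *(1)]
      continuous_on_koszul [OF continuous_on_poly_forms [OF *(2)]]])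
qed (use assms in \<open>simp add: trimmed_forms_def zero_fun_def\<close>)

text \<open>On the line through \<open>x\<close> and \<open>y\<close> the function is a polynomial
  in one variable that vanishes near parameter 0. It has infinitely many roots, so it also vanishes
  at parameter 1.\<close>

lemma real_polynomial_function_eq_0_of_open:
  fixes f :: "'a::euclidean_space \<Rightarrow> real"
  assumes f: "real_polynomial_function f" and "open U" "x \<in> U" and 0: "\<And>y. y \<in> U \<Longrightarrow> f y = 0"
  shows "f y = 0"
proof -
  define g where "g = (\<lambda>t::real. f (x + t *\<^sub>R (y - x)))"
  have "real_polynomial_function g"
    unfolding g_def
    by (rule real_polynomial_function_compose [OF _ f, unfolded o_def])
      (intro polynomial_function_add polynomial_function_const polynomial_function_mult polynomial_function_id
        polynomial_function_bounded_linear bounded_linear_scaleR_left)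
  then obtain a n where g: "g = (\<lambda>t. \<Sum>i\<le>n. a i * t ^ i)"
    unfolding real_polynomial_function_iff_sum by blast
  have "open ((\<lambda>t::real. x + t *\<^sub>R (y - x)) -` U)"
    by (intro open_vimage \<open>open U\<close> continuous_intros)
  moreover have "0 \<in> (\<lambda>t::real. x + t *\<^sub>R (y - x)) -` U"
    using \<open>x \<in> U\<close> by simp
  ultimately have "infinite ((\<lambda>t::real. x + t *\<^sub>R (y - x)) -` U)"
    using finite_imp_not_open by blast
  moreover have "(\<lambda>t::real. x + t *\<^sub>R (y - x)) -` U \<subseteq> {t. (\<Sum>i\<le>n. a i * t ^ i) = 0}"
  proof
    fix t assume "t \<in> (\<lambda>t::real. x + t *\<^sub>R (y - x)) -` U"
    then have "g t = 0" using 0 by (simp add: g_def)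
    then show "t \<in> {t. (\<Sum>i\<le>n. a i * t ^ i) = 0}" by (simp add: g)
  qed
  ultimately have "infinite {t. (\<Sum>i\<le>n. a i * t ^ i) = 0}"
    using finite_subset by blast
  then have "\<forall>i\<le>n. a i = 0"
    using polyfun_finite_roots [of a n] by blast
  then have "g 1 = 0"
    by (subst g) simp
  then show ?thesis
    by (simp add: g_def)
qed

section \<open>Polynomial representatives\<close>

lemma ae_eq_on_iff:
  assumes "U \<in> sets lebesgue"
  shows "ae_eq_on U \<omega> \<eta> \<longleftrightarrow> (AE x in lebesgue. x \<in> U \<longrightarrow> \<omega> x = \<eta> x)"
  unfolding ae_eq_on_def using assms by (subst AE_restrict_space_iff) auto

text \<open>The zero set of the difference is closed, so equality almost everywhere becomes equality
  on the whole interior, and the identity theorem extends it to all of space. The degrees may differ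
  because \<open>poly_rep\<close> ranges over all of them.\<close>

lemma poly_forms_eqI:
  fixes \<eta> \<zeta> :: "('n::{finite,linorder}) dform"
  assumes "\<eta> \<in> poly_forms r k" "\<zeta> \<in> poly_forms s k"
    and U: "U \<in> sets lebesgue" "interior U \<noteq> {}" and eq: "ae_eq_on U \<eta> \<zeta>"
  shows "\<eta> = \<zeta>"
proof -
  define \<xi> where "\<xi> = \<eta> - \<zeta>"
  have \<xi>: "\<xi> \<in> poly_forms (max r s) k"
    unfolding \<xi>_def
    using assms(1,2) poly_forms_mono [of r "max r s" k] poly_forms_mono [of s "max r s" k]
    by (intro subspace_diff [OF subspace_poly_forms]) auto
  have AE: "AE x in lebesgue. x \<in> interior U \<longrightarrow> \<xi> x = 0"
    using eq interior_subset[of U] unfolding ae_eq_on_iff [OF U(1)]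
    by (auto simp: \<xi>_def elim!: eventually_mono)
  have "closed (\<xi> -` {0})"
    by (intro continuous_closed_vimage closed_singleton)
      (use continuous_on_poly_forms [OF \<xi>, of UNIV] in \<open>simp add: continuous_on_eq_continuous_at\<close>)
  then have 0: "\<xi> x = 0" if "x \<in> interior U" for x
    using mem_closed_if_AE_lebesgue_open [of "interior U" "\<xi> -` {0}" x] AE that by simp
  obtain z where z: "z \<in> interior U"
    using U(2) by blast
  have "\<xi> x $ I = 0" for x I
    using real_polynomial_function_eq_0_of_open
      [OF real_polynomial_function_poly_forms [OF \<xi>] open_interior z] 0 by simp
  then show ?thesis
    by (simp add: \<xi>_def fun_eq_iff vec_eq_iff)
qed

lemma poly_rep_eqI:
  assumes "\<eta> \<in> poly_forms s (int k)" "U \<in> sets lebesgue" "interior U \<noteq> {}" "ae_eq_on U \<omega> \<eta>"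
  shows "poly_rep k U \<omega> = \<eta>"
  unfolding poly_rep_def
proof (rule the_equality)
  fix \<zeta> assume \<zeta>: "(\<exists>s. \<zeta> \<in> poly_forms s (int k)) \<and> ae_eq_on U \<omega> \<zeta>"
  then obtain s' where s': "\<zeta> \<in> poly_forms s' (int k)" by blast
  have "ae_eq_on U \<zeta> \<eta>"
    using \<zeta> assms(4) unfolding ae_eq_on_def by auto
  then show "\<zeta> = \<eta>"
    by (rule poly_forms_eqI [OF s' assms(1-3)])
qed (use assms in auto)

lemma poly_forms_subset_span:
  "poly_forms (int r) (int k) \<subseteq>
    span ((\<lambda>(\<alpha>, I) x. monomial \<alpha> x *\<^sub>R (axis I 1 :: ('n::{finite,linorder}) covec)) `
      ({\<alpha>. sum \<alpha> UNIV \<le> r} \<times> UNIV))"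
proof
  fix \<omega> :: "'n dform"
  assume "\<omega> \<in> poly_forms (int r) (int k)"
  then obtain c where c: "\<omega> = (\<lambda>x. \<Sum>\<alpha> | sum \<alpha> UNIV \<le> r. monomial \<alpha> x *\<^sub>R c \<alpha>)"
    unfolding poly_forms_nat by blast
  have "c \<alpha> = (\<Sum>I\<in>UNIV. c \<alpha> $ I *\<^sub>R axis I 1)" for \<alpha>
    by (simp add: vec_eq_iff axis_def if_distrib cong: if_cong)
  then have "\<omega> = (\<Sum>\<alpha> | sum \<alpha> UNIV \<le> r. \<Sum>I\<in>UNIV. c \<alpha> $ I *\<^sub>R (\<lambda>x. monomial \<alpha> x *\<^sub>R axis I 1))"
    unfolding c by (auto simp: fun_eq_iff sum_fun_apply scaleR_fun_def scaleR_sum_right mult.commute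
        intro!: sum.cong) (metis (no_types, lifting) scaleR_scaleR scaleR_sum_right sum.cong)
  also have "\<dots> \<in> span ((\<lambda>(\<alpha>, I) x. monomial \<alpha> x *\<^sub>R axis I 1) ` ({\<alpha>. sum \<alpha> UNIV \<le> r} \<times> UNIV))"
    by (intro span_sum span_scale span_base) force
  finally show "\<omega> \<in> span ((\<lambda>(\<alpha>, I) x. monomial \<alpha> x *\<^sub>R (axis I 1 :: 'n covec)) `
      ({\<alpha>. sum \<alpha> UNIV \<le> r} \<times> UNIV))" .
qed


section \<open>Lebesgue norms\<close>

text \<open>On the boundary, where one argument is zero, convexity reduces to
  \<open>c powr q \<le> c\<close> for c between 0 and 1.\<close>

lemma powr_convex_nonneg:
  fixes x y a b q :: real
  assumes "1 \<le> q" "0 \<le> x" "0 \<le> y" "0 < a" "0 < b" "a + b = 1"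
  shows "(a * x + b * y) powr q \<le> a * x powr q + b * y powr q"
proof -
  have le: "c powr q \<le> c" if "0 < c" "c < 1" for c :: real
    using powr_mono' [of 1 q c] that assms(1) by simp
  consider "x = 0" | "y = 0" | "0 < x" "0 < y"
    using assms by linarith
  then show ?thesis
  proof cases
    case 1
    then show ?thesis
      using assms le [of b] by (simp add: powr_mult mult_right_mono)
  next
    case 2
    then show ?thesis
      using assms le [of a] by (simp add: powr_mult mult_right_mono)
  next
    case 3
    have a: "a = 1 - b"
      using assms(6) by simp
    show ?thesis
      using convex_onD [OF powr_convex [OF assms(1)], of b x y] 3 assms(4,5) unfolding a by simp
  qed
qed

lemma ennroot_le_iff:
  assumes "1 \<le> p" "p \<noteq> \<infinity>" "0 \<le> a"
  shows "ennroot p I \<le> ennreal a \<longleftrightarrow> I \<le> ennreal (a powr enn2real p)"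
proof -
  have q: "1 \<le> enn2real p"
    using assms by (cases p) auto
  show ?thesis
  proof (cases I)
    case (real x)
    have "x powr (1 / enn2real p) \<le> a \<longleftrightarrow> x \<le> a powr enn2real p"
    proof
      assume "x powr (1 / enn2real p) \<le> a"
      then have "(x powr (1 / enn2real p)) powr enn2real p \<le> a powr enn2real p"
        using q by (intro powr_mono2) auto
      then show "x \<le> a powr enn2real p"
        using real q by (simp add: powr_powr)
    next
      assume "x \<le> a powr enn2real p"
      then have "x powr (1 / enn2real p) \<le> (a powr enn2real p) powr (1 / enn2real p)"
        using q real by (intro powr_mono2) auto
      then show "x powr (1 / enn2real p) \<le> a"
        using assms q by (simp add: powr_powr)
    qed
    then show ?thesis
      using real assms by (simp add: ennroot_def ennreal_le_iff)
  qed (simp add: ennroot_def top_unique)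
qed

lemma ennroot_mono:
  assumes "1 \<le> p" "I \<le> J"
  shows "ennroot p I \<le> ennroot p J"
proof (cases "J = \<infinity>")
  case False
  then have "enn2real I \<le> enn2real J" "I \<noteq> \<infinity>"
    using assms by (auto intro: enn2real_mono simp: top_unique less_top)
  then show ?thesis
    using False by (auto simp: ennroot_def intro!: ennreal_leI powr_mono2)
qed (simp add: ennroot_def)

text \<open>The condition on \<open>g\<close> covers restriction to a smaller set, extension by zero
  and change on a null set at once. These are the operations that relate the domain, the patches and
  \<open>T\<close>; the norm comparison below uses the same condition.\<close>

lemma borel_measurable_lebesgue_on_AE:
  fixes f g :: "'a::euclidean_space \<Rightarrow> 'b::euclidean_space"
  assumes "f \<in> borel_measurable (lebesgue_on S)" "S \<in> sets lebesgue" "T \<in> sets lebesgue"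
    and "AE x in lebesgue. x \<in> T \<longrightarrow> g x = (if x \<in> S then f x else 0)"
  shows "g \<in> borel_measurable (lebesgue_on T)"
proof -
  have "(\<lambda>x. if x \<in> S then f x else 0) \<in> borel_measurable (lebesgue_on T)"
    using borel_measurable_if_I [OF assms(1,2)] by (simp add: measurable_restrict_space1)
  from borel_measurable_if_I [OF this assms(3)]
  have "(\<lambda>x. if x \<in> T then if x \<in> S then f x else 0 else 0) \<in> borel_measurable lebesgue" .
  then have "(\<lambda>x. if x \<in> T then g x else 0) \<in> borel_measurable lebesgue"
    by (rule borel_measurable_AE) (use assms(4) in \<open>auto elim!: eventually_mono\<close>)
  then show ?thesis
    by (rule borel_measurable_if_D)
qed

lemma Lp_norm_mono_AE:
  assumes p: "1 \<le> p" and f: "f \<in> borel_measurable (lebesgue_on S)"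
    and S: "S \<in> sets lebesgue" "T \<in> sets lebesgue"
    and AE: "AE x in lebesgue. x \<in> T \<longrightarrow> g x = (if x \<in> S then f x else 0)"
  shows "Lp_norm p T g \<le> Lp_norm p S f"
proof (cases "p = \<infinity>")
  case True
  \<comment> \<open>The essential supremum of a nonmeasurable function is infinite by definition, so
    measurability has to come first.\<close>
  have [measurable]: "g \<in> borel_measurable (lebesgue_on T)"
    by (rule borel_measurable_lebesgue_on_AE [OF f S AE])
  have "AE x in lebesgue. x \<in> S \<longrightarrow> ennreal (norm (f x)) \<le> esssup (lebesgue_on S) (\<lambda>x. ennreal (norm (f x)))"
    using esssup_AE [of "\<lambda>x. ennreal (norm (f x))" "lebesgue_on S"] S
    by (subst (asm) AE_restrict_space_iff) auto
  with AE have "AE x in lebesgue. x \<in> T \<longrightarrow> ennreal (norm (g x)) \<le> esssup (lebesgue_on S) (\<lambda>x. ennreal (norm (f x)))"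
    by eventually_elim auto
  then have "AE x in lebesgue_on T. ennreal (norm (g x)) \<le> esssup (lebesgue_on S) (\<lambda>x. ennreal (norm (f x)))"
    using S by (subst AE_restrict_space_iff) auto
  then show ?thesis
    using True by (auto simp: Lp_norm_def intro!: esssup_I)
next
  case False
  have "(\<integral>\<^sup>+ x. ennreal (norm (g x) powr enn2real p) \<partial>lebesgue_on T) \<le>
    (\<integral>\<^sup>+ x. ennreal (norm (f x) powr enn2real p) \<partial>lebesgue_on S)"
    using S AE
    by (simp add: nn_integral_restrict_space, intro nn_integral_mono_AE)
      (auto elim!: eventually_mono simp: indicator_def)
  then show ?thesis
    using False p by (simp add: Lp_norm_def ennroot_mono)
qed

text \<open>Minkowski's inequality. For finite \<open>p\<close> take \<open>a\<close> and
  \<open>b\<close> slightly above the two norms: the norm of the sum is then at most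
  \<open>a + b\<close> times a convex combination of |f|/a and |g|/b, whose q-th powers have
  integral at most 1, and convexity of the power gives the claim.\<close>

lemma Lp_norm_triangle:
  assumes p: "1 \<le> p" and [measurable]: "f \<in> borel_measurable (lebesgue_on U)" "g \<in> borel_measurable (lebesgue_on U)"
  shows "Lp_norm p U (\<lambda>x. f x + g x) \<le> Lp_norm p U f + Lp_norm p U g"
proof (cases "p = \<infinity>")
  case True
  have "AE x in lebesgue_on U. ennreal (norm (f x + g x)) \<le>
      esssup (lebesgue_on U) (\<lambda>x. ennreal (norm (f x))) + esssup (lebesgue_on U) (\<lambda>x. ennreal (norm (g x)))"
    using esssup_AE [of "\<lambda>x. ennreal (norm (f x))" "lebesgue_on U"]
      esssup_AE [of "\<lambda>x. ennreal (norm (g x))" "lebesgue_on U"]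
  proof eventually_elim
    case (elim x)
    have "ennreal (norm (f x + g x)) \<le> ennreal (norm (f x)) + ennreal (norm (g x))"
      by (simp add: ennreal_plus [symmetric] norm_triangle_ineq del: ennreal_plus)
    also have "\<dots> \<le> esssup (lebesgue_on U) (\<lambda>x. ennreal (norm (f x))) + esssup (lebesgue_on U) (\<lambda>x. ennreal (norm (g x)))"
      by (intro add_mono elim)
    finally show ?case .
  qed
  then show ?thesis
    using True by (auto simp: Lp_norm_def intro!: esssup_I)
next
  case False
  define q where "q = enn2real p"
  have q: "1 \<le> q"
    using p False unfolding q_def by (cases p) auto
  show ?thesis
  proof (cases "Lp_norm p U f = \<infinity> \<or> Lp_norm p U g = \<infinity>")
    case True
    then show ?thesis by auto
  next
    case fin: False
    then obtain A B where AB: "Lp_norm p U f = ennreal A" "0 \<le> A" "Lp_norm p U g = ennreal B" "0 \<le> B"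
      by (metis ennreal_cases infinity_ennreal_def)
    have "Lp_norm p U (\<lambda>x. f x + g x) \<le> ennreal A + ennreal B + ennreal e" if "0 < e" for e
    proof -
      \<comment> \<open>Enlarging the two norms makes it possible to divide by them.\<close>
      define a b where "a = A + e / 2" and "b = B + e / 2"
      have ab: "0 < a" "0 < b" "A \<le> a" "B \<le> b"
        using AB \<open>0 < e\<close> by (auto simp: a_def b_def)
      \<comment> \<open>The coefficients of |f|^q and |g|^q after the normalisation is undone. As
        the integrals of these powers are at most a^q and b^q, the identity for
        \<open>c * a powr q + d * b powr q\<close> closes the estimate.\<close>
      define c d where "c = (a + b) powr q * (a / (a + b) / a powr q)"
        and "d = (a + b) powr q * (b / (a + b) / b powr q)"
      have "c * a powr q = (a + b) powr q * (a / (a + b))" "d * b powr q = (a + b) powr q * (b / (a + b))"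
        using ab by (simp_all add: c_def d_def)
      moreover have "a / (a + b) + b / (a + b) = 1"
        using ab by (simp add: add_divide_distrib [symmetric])
      ultimately have "c * a powr q + d * b powr q = (a + b) powr q"
        by (metis distrib_left mult.right_neutral)
      then have cd: "0 \<le> c" "0 \<le> d" "c * a powr q + d * b powr q = (a + b) powr q"
        using ab by (auto simp: c_def d_def)
      have f: "(\<integral>\<^sup>+ x. ennreal (norm (f x) powr q) \<partial>lebesgue_on U) \<le> ennreal (a powr q)"
        using AB(1) ab p False
        by (subst ennroot_le_iff [symmetric, of p a, folded q_def]) (auto simp: Lp_norm_def q_def ennreal_leI)
      have g: "(\<integral>\<^sup>+ x. ennreal (norm (g x) powr q) \<partial>lebesgue_on U) \<le> ennreal (b powr q)"
        using AB(3) ab p False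
        by (subst ennroot_le_iff [symmetric, of p b, folded q_def]) (auto simp: Lp_norm_def q_def ennreal_leI)
      have *: "norm (f x + g x) powr q \<le> c * norm (f x) powr q + d * norm (g x) powr q" for x
      proof -
        define s t where "s = norm (f x) / a" and "t = norm (g x) / b"
        have st: "norm (f x) = a * s" "norm (g x) = b * t" "0 \<le> s" "0 \<le> t"
          using ab by (auto simp: s_def t_def)
        have "norm (f x + g x) powr q \<le> (a * s + b * t) powr q"
          using q st norm_triangle_ineq [of "f x" "g x"] by (intro powr_mono2) auto
        also have "a * s + b * t = (a + b) * (a / (a + b) * s + b / (a + b) * t)"
        proof -
          have "(a + b) * (a / (a + b) * s) = a * s" "(a + b) * (b / (a + b) * t) = b * t"
            using ab by simp_all
          then show ?thesis
            by (simp only: distrib_left [of "a + b"])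
        qed
        also have "\<dots> powr q = (a + b) powr q * (a / (a + b) * s + b / (a + b) * t) powr q"
          by (rule powr_mult)
        also have "\<dots> \<le> (a + b) powr q * (a / (a + b) * s powr q + b / (a + b) * t powr q)"
          using ab st q by (intro mult_left_mono powr_convex_nonneg) (auto simp: add_divide_distrib [symmetric])
        also have "\<dots> = c * norm (f x) powr q + d * norm (g x) powr q"
          using ab st unfolding st(1,2) c_def d_def by (simp add: powr_mult distrib_left)
        finally show ?thesis .
      qed
      have "(\<integral>\<^sup>+ x. ennreal (norm (f x + g x) powr q) \<partial>lebesgue_on U) \<le>
          (\<integral>\<^sup>+ x. ennreal c * ennreal (norm (f x) powr q) + ennreal d * ennreal (norm (g x) powr q) \<partial>lebesgue_on U)"
        using * cd(1,2) by (intro nn_integral_mono)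
          (simp add: ennreal_mult [symmetric] ennreal_plus [symmetric] ennreal_leI del: ennreal_plus)
      also have "\<dots> = ennreal c * (\<integral>\<^sup>+ x. ennreal (norm (f x) powr q) \<partial>lebesgue_on U) +
          ennreal d * (\<integral>\<^sup>+ x. ennreal (norm (g x) powr q) \<partial>lebesgue_on U)"
        by (simp add: nn_integral_add nn_integral_cmult)
      also have "\<dots> \<le> ennreal c * ennreal (a powr q) + ennreal d * ennreal (b powr q)"
        by (intro add_mono mult_left_mono f g) auto
      also have "\<dots> = ennreal ((a + b) powr q)"
        using cd by (simp add: ennreal_mult [symmetric] ennreal_plus [symmetric] del: ennreal_plus)
      finally have "Lp_norm p U (\<lambda>x. f x + g x) \<le> ennreal (a + b)"
        using ennroot_le_iff [OF p False, of "a + b"] False ab by (simp add: Lp_norm_def q_def del: ennreal_plus)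
      also have "\<dots> = ennreal A + ennreal B + ennreal e"
        using AB \<open>0 < e\<close> by (simp add: a_def b_def ennreal_plus [symmetric] del: ennreal_plus)
      finally show ?thesis .
    qed
    then show ?thesis
      unfolding AB(1,3) by (rule ennreal_le_epsilon)
  qed
qed

lemma Lp_norm_zero: "1 \<le> p \<Longrightarrow> Lp_norm p U (\<lambda>x. 0) = 0"
proof (cases "p = \<infinity>")
  case True
  have "esssup (lebesgue_on U) (\<lambda>x. ennreal 0) \<le> 0"
    by (rule esssup_I) auto
  then show ?thesis using True by (simp add: Lp_norm_def)
qed (simp add: Lp_norm_def ennroot_def)

lemma Lp_norm_sum:
  assumes p: "1 \<le> p" and "\<And>i. i \<in> I \<Longrightarrow> f i \<in> borel_measurable (lebesgue_on U)"
  shows "Lp_norm p U (\<lambda>x. \<Sum>i\<in>I. f i x) \<le> (\<Sum>i\<in>I. Lp_norm p U (f i))"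
  using assms(2)
proof (induction I rule: infinite_finite_induct)
  case (insert i I)
  have "Lp_norm p U (\<lambda>x. \<Sum>i\<in>insert i I. f i x) = Lp_norm p U (\<lambda>x. f i x + (\<Sum>i\<in>I. f i x))"
    using insert.hyps by simp
  also have "\<dots> \<le> Lp_norm p U (f i) + Lp_norm p U (\<lambda>x. \<Sum>i\<in>I. f i x)"
    by (intro Lp_norm_triangle p borel_measurable_sum insert.prems) auto
  also have "\<dots> \<le> Lp_norm p U (f i) + (\<Sum>i\<in>I. Lp_norm p U (f i))"
    using insert by (intro add_left_mono) auto
  finally show ?case
    using insert.hyps by simp
qed (simp_all add: Lp_norm_zero p)

lemma Lp_norm_diff_commute: "Lp_norm p U (\<lambda>x. f x - g x) = Lp_norm p U (\<lambda>x. g x - f x)"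
  by (simp add: Lp_norm_def norm_minus_commute)

text \<open>Weak derivatives demand local integrability even at order zero. A compact set has finite
  measure, so for finite \<open>p\<close> the bound t <= 1 + t^q does the work of Hoelder's
  inequality.\<close>

lemma locally_integrable_Lp_forms:
  assumes p: "1 \<le> p" and \<omega>: "\<omega> \<in> Lp_forms p k U" and U: "U \<in> sets lebesgue"
  shows "locally_integrable U \<omega>"
  unfolding locally_integrable_def
proof (intro allI impI)
  fix K assume K: "compact K \<and> K \<subseteq> U"
  then have Ks: "K \<in> sets lebesgue" and Km: "emeasure lebesgue K < \<infinity>"
    using lmeasurable_compact [of K] by (auto simp: fmeasurable_def)
  have meas [measurable]: "\<omega> \<in> borel_measurable (lebesgue_on K)"
    using \<omega> K by (auto simp: Lp_forms_def intro: measurable_restrict_mono)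
  have "Lp_norm p K \<omega> \<le> Lp_norm p U \<omega>"
    using K \<omega> by (intro Lp_norm_mono_AE p Ks U) (auto simp: Lp_forms_def)
  then have fin: "Lp_norm p K \<omega> < \<infinity>"
    using \<omega> by (auto simp: Lp_forms_def intro: le_less_trans)
  have "(\<integral>\<^sup>+ x. ennreal (norm (\<omega> x)) \<partial>lebesgue_on K) < \<infinity>"
  proof (cases "p = \<infinity>")
    case True
    have "(\<integral>\<^sup>+ x. ennreal (norm (\<omega> x)) \<partial>lebesgue_on K) \<le> (\<integral>\<^sup>+ x. Lp_norm p K \<omega> \<partial>lebesgue_on K)"
      using True esssup_AE [of "\<lambda>x. ennreal (norm (\<omega> x))" "lebesgue_on K"]
      by (intro nn_integral_mono_AE) (simp add: Lp_norm_def)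
    also have "\<dots> < \<infinity>"
      using fin Km Ks by (simp add: emeasure_restrict_space ennreal_mult_less_top)
    finally show ?thesis .
  next
    case False
    have q: "1 \<le> enn2real p"
      using p False by (cases p) auto
    have "norm (\<omega> x) \<le> 1 + norm (\<omega> x) powr enn2real p" for x
    proof (cases "norm (\<omega> x) \<le> 1")
      case False
      then show ?thesis
        using powr_mono [OF q, of "norm (\<omega> x)"] by simp
    qed (simp add: add_increasing2)
    then have "(\<integral>\<^sup>+ x. ennreal (norm (\<omega> x)) \<partial>lebesgue_on K) \<le>
        (\<integral>\<^sup>+ x. 1 + ennreal (norm (\<omega> x) powr enn2real p) \<partial>lebesgue_on K)"
      by (intro nn_integral_mono) (metis ennreal_1 ennreal_leI ennreal_plus powr_ge_zero zero_le_one)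
    also have "\<dots> = emeasure lebesgue K + (\<integral>\<^sup>+ x. ennreal (norm (\<omega> x) powr enn2real p) \<partial>lebesgue_on K)"
      using Ks by (simp add: nn_integral_add emeasure_restrict_space)
    also have "\<dots> < \<infinity>"
      using fin Km False by (auto simp: Lp_norm_def ennroot_def less_top split: if_splits)
    finally show ?thesis .
  qed
  then show "integrable (lebesgue_on K) \<omega>"
    by (intro integrableI_bounded meas)
qed

section \<open>Sobolev forms of order zero\<close>

lemma sobolev_seminorm_0: "sobolev_seminorm p 0 U \<omega> = Lp_norm p U \<omega>"
proof -
  have "{\<alpha> :: 'a \<Rightarrow> nat. sum \<alpha> UNIV = 0} = {\<lambda>_. 0}"
    by auto
  then show ?thesis
    by (simp add: sobolev_seminorm_def weak_deriv_def)
qed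

lemma pderiv_multi_0: "pderiv_multi (\<lambda>_. 0) \<phi> = \<phi>"
proof -
  have "foldr (\<lambda>i. id) xs \<phi> = \<phi>" for xs :: "'a list"
    by (induction xs) auto
  then show ?thesis
    by (simp add: pderiv_multi_def id_def)
qed

text \<open>This opens the approximation estimate of the local projections, with m = 0, to every L^p
  form.\<close>

lemma sobolev_forms_0:
  assumes p: "1 \<le> p" and \<omega>: "\<omega> \<in> Lp_forms p k U" and U: "U \<in> sets lebesgue"
  shows "\<omega> \<in> sobolev_forms p 0 k U"
proof -
  have "is_weak_deriv U \<alpha> \<omega> \<omega>" if "sum \<alpha> UNIV = 0" for \<alpha> :: "'a \<Rightarrow> nat"
  proof -
    have "\<alpha> = (\<lambda>_. 0)" using that by auto
    then show ?thesis
      using locally_integrable_Lp_forms [OF assms] by (simp add: is_weak_deriv_def pderiv_multi_0)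
  qed
  then show ?thesis
    using \<omega> by (auto simp: sobolev_forms_def sobolev_seminorm_0 Lp_forms_def)
qed


section \<open>Traces and degrees of freedom\<close>

text \<open>A member of \<open>V\<close> outside the span would enlarge the family to
  \<open>dim V + 1\<close> independent vectors inside the span of a basis with \<open>dim V\<close>
  elements. The finite set \<open>W\<close> makes that basis finite; the ambient function space does
  not.\<close>

lemma finite_dim_independent_family_spans:
  fixes f :: "'i \<Rightarrow> 'a::real_vector"
  assumes "finite W" "V \<subseteq> span W" and f: "\<And>i. i \<in> I \<Longrightarrow> f i \<in> V" and I: "finite I" "card I = dim V"
    and indep: "\<And>c i. (\<Sum>i\<in>I. c i *\<^sub>R f i) = 0 \<Longrightarrow> i \<in> I \<Longrightarrow> c i = (0::real)"
    and v: "v \<in> V"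
  shows "\<exists>c. v = (\<Sum>i\<in>I. c i *\<^sub>R f i)"
proof -
  have inj: "inj_on f I"
  proof (rule inj_onI, rule ccontr)
    fix i j assume ij: "i \<in> I" "j \<in> I" "f i = f j" "i \<noteq> j"
    \<comment> \<open>A repeated member would yield the forbidden relation with coefficients 1 and
      -1.\<close>
    define c where "c l = (if l = i then 1 else if l = j then -1 else (0::real))" for l
    have "(\<Sum>l\<in>I. c l *\<^sub>R f l) = (\<Sum>l\<in>{i, j}. c l *\<^sub>R f l)"
      using ij I(1) by (intro sum.mono_neutral_right) (auto simp: c_def)
    also have "\<dots> = 0"
      using ij by (simp add: c_def)
    finally have "c i = 0"
      using indep ij(1) by blast
    then show False
      by (simp add: c_def)
  qed
  have independent: "independent (f ` I)"
  proof
    assume "dependent (f ` I)"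
    then obtain u w where "w \<in> f ` I" "u w \<noteq> 0" "(\<Sum>w\<in>f ` I. u w *\<^sub>R w) = 0"
      using I(1) by (auto simp: real_vector.dependent_finite)
    then show False
      using indep [of "\<lambda>i. u (f i)"] inj by (auto simp: sum.reindex)
  qed
  have "v \<in> span (f ` I)"
  proof (rule ccontr)
    assume v': "v \<notin> span (f ` I)"
    obtain b where b: "b \<subseteq> V" "independent b" "V \<subseteq> span b" "card b = dim V"
      using real_vector.basis_exists [of V] by blast
    have "b \<subseteq> span W"
      using b(1) assms(2) by (rule order_trans)
    then have fin: "finite b"
      using real_vector.independent_span_bound [OF assms(1) b(2)] by simp
    have ins: "independent (insert v (f ` I))"
      using v' independent by (rule real_vector.independent_insertI)
    have "insert v (f ` I) \<subseteq> V"
      using v f by auto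
    then have "insert v (f ` I) \<subseteq> span b"
      using b(3) by (rule order_trans)
    from conjunct2 [OF real_vector.independent_span_bound [OF fin ins this]]
    have "card (insert v (f ` I)) \<le> card b" .
    moreover have "v \<notin> f ` I"
    proof
      assume "v \<in> f ` I"
      then have "v \<in> span (f ` I)"
        by (rule real_vector.span_base)
      then show False using v' by simp
    qed
    ultimately show False
      using I b(4) inj by (simp add: card_image)
  qed
  then obtain u where "v = (\<Sum>w\<in>f ` I. u w *\<^sub>R w)"
    using I(1) by (auto simp: real_vector.span_finite)
  then show ?thesis
    using inj by (auto simp: sum.reindex)
qed

section \<open>Tangent spaces, frames and integrals in charts\<close>

lemma tangent_eq_span:
  assumes "a \<in> S"
  shows "tangent S = span ((+) (- a) ` S)"
  unfolding tangent_def
proof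
  have "x - y \<in> span ((+) (- a) ` S)" if "x \<in> S" "y \<in> S" for x y
  proof -
    have "x - y = (- a + x) - (- a + y)"
      by simp
    then show ?thesis
      using that by (metis image_eqI span_base span_diff)
  qed
  then show "span {x - y |x y. x \<in> S \<and> y \<in> S} \<subseteq> span ((+) (- a) ` S)"
    by (intro span_minimal) auto
  show "span ((+) (- a) ` S) \<subseteq> span {x - y |x y. x \<in> S \<and> y \<in> S}"
    using assms by (intro span_mono) force
qed

lemma dim_tangent:
  assumes "S \<noteq> {}"
  shows "dim (tangent S) = simplex_dim S"
proof -
  obtain a where a: "a \<in> S" using assms by blast
  have "aff_dim S = int (dim ((+) (- a) ` S))"
    using a by (intro aff_dim_eq_dim hull_inc)
  then show ?thesis
    by (simp add: tangent_eq_span [OF a] simplex_dim_def)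
qed

text \<open>An orthonormal basis of the tangent space exists and has \<open>simplex_dim S\<close>
  elements, so the choice in \<open>frame\<close> is a genuine one.\<close>

lemma frame:
  assumes "S \<noteq> {}"
  shows "distinct (frame S)" "length (frame S) = simplex_dim S" "\<forall>e\<in>set (frame S). norm e = 1"
    "pairwise orthogonal (set (frame S))" "span (set (frame S)) = tangent S"
proof -
  have "subspace (tangent S)"
    by (simp add: tangent_def)
  then obtain B where B: "B \<subseteq> tangent S" "pairwise orthogonal B" "\<And>x. x \<in> B \<Longrightarrow> norm x = 1"
      "independent B" "card B = dim (tangent S)" "span B = tangent S"
    by (rule orthonormal_basis_subspace) (rule that)
  then have "finite B"
    by (simp add: independent_imp_finite)
  then obtain es where es: "set es = B" "distinct es"
    using finite_distinct_list by blast
  then have "length es = simplex_dim S"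
    using B(5) dim_tangent [OF assms] distinct_card by metis
  with es B have "\<exists>es. distinct es \<and> length es = simplex_dim S \<and>
    (\<forall>e\<in>set es. norm e = 1) \<and> pairwise orthogonal (set es) \<and> span (set es) = tangent S"
    by blast
  from someI_ex [OF this] show "distinct (frame S)" "length (frame S) = simplex_dim S"
      "\<forall>e\<in>set (frame S). norm e = 1"
      "pairwise orthogonal (set (frame S))" "span (set (frame S)) = tangent S"
    unfolding frame_def by blast+
qed

lemma chart_component:
  assumes "S \<noteq> {}" "i < simplex_dim S"
  shows "inner (chart S t - (SOME x. x \<in> S)) (frame S ! i) = t i"
proof -
  note fr = frame [OF assms(1)]
  have "inner (frame S ! j) (frame S ! i) = (if j = i then 1 else 0)" if "j < simplex_dim S" for j
  proof (cases "j = i")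
    case True
    have "norm (frame S ! i) = 1"
      using fr assms(2) by auto
    then show ?thesis
      using True by (simp add: norm_eq_1)
  next
    case False
    then have "frame S ! j \<noteq> frame S ! i"
      using fr that assms(2) by (simp add: nth_eq_iff_index_eq)
    then show ?thesis
      using fr that assms(2) False by (auto simp: pairwise_def orthogonal_def)
  qed
  then have "(\<Sum>j<simplex_dim S. t j * inner (frame S ! j) (frame S ! i)) =
      (\<Sum>j<simplex_dim S. if j = i then t j else 0)"
    by (intro sum.cong) auto
  then show ?thesis
    using assms(2) by (simp add: chart_def inner_sum_left)
qed

abbreviation chart_measure :: "('n::{finite,linorder}) point set \<Rightarrow> (nat \<Rightarrow> real) measure"
  where "chart_measure S \<equiv> \<Pi>\<^sub>M i\<in>{..<simplex_dim S}. lborel"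

lemma chart_measurable: "chart S \<in> borel_measurable (chart_measure S)"
  unfolding chart_def by measurable

text \<open>Additivity of a degree of freedom rests on integrability, as nonintegrable functions
  have integral 0. The coordinates of a point of \<open>S\<close> are inner products with unit
  vectors, hence bounded by the diameter; so the integrand is bounded and lives on a cube of finite
  measure.\<close>

lemma integrable_chart:
  fixes h :: "('n::{finite,linorder}) point \<Rightarrow> real"
  assumes S: "compact S" "S \<noteq> {}" and h: "continuous_on S h"
  shows "integrable (chart_measure S) (\<lambda>t. indicator (chart_domain S) t * h (chart S t))"
proof -
  interpret product_sigma_finite "\<lambda>_::nat. lborel :: real measure" ..
  let ?x = "SOME x. x \<in> S"
  have x: "?x \<in> S"
    using S(2) by (simp add: some_in_eq)
  define A where "A = PiE {..<simplex_dim S} (\<lambda>_. {- diameter S..diameter S})"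
  have A: "A \<in> sets (chart_measure S)"
    unfolding A_def by (intro sets_PiM_I_finite) auto
  have fin: "emeasure (chart_measure S) A < \<infinity>"
    unfolding A_def by (subst emeasure_PiM) (auto simp: emeasure_lborel_Icc_eq ennreal_power less_top [symmetric])
  \<comment> \<open>Points of the product space are extensional, so \<open>chart_domain S\<close> is
    there the preimage of \<open>S\<close> and the integrand is a composition with the measurable
    \<open>chart S\<close>.\<close>
  have eq: "indicator (chart_domain S) t * h (chart S t) = indicator S (chart S t) *\<^sub>R h (chart S t)"
    if "t \<in> space (chart_measure S)" for t
    using that by (auto simp: chart_domain_def space_PiM PiE_def indicator_def)
  have "(\<lambda>x. indicator S x *\<^sub>R h x) \<in> borel_measurable borel"
    using S by (intro borel_measurable_continuous_on_indicator h) (auto simp: compact_imp_closed)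
  then have "(\<lambda>t. indicator S (chart S t) *\<^sub>R h (chart S t)) \<in> borel_measurable (chart_measure S)"
    by (rule measurable_compose [OF chart_measurable])
  then have meas: "(\<lambda>t. indicator (chart_domain S) t * h (chart S t)) \<in> borel_measurable (chart_measure S)"
    by (subst measurable_cong [OF eq]) auto
  have "bounded (h ` S)"
    using S h by (intro compact_imp_bounded compact_continuous_image)
  then obtain B where B: "\<And>x. x \<in> S \<Longrightarrow> norm (h x) \<le> B"
    by (auto simp: bounded_iff)
  have "0 \<le> B"
    using B [OF x] by (meson norm_ge_zero order_trans)
  have sub: "t \<in> A" if t: "t \<in> chart_domain S" for t
  proof -
    have "\<bar>t i\<bar> \<le> diameter S" if "i < simplex_dim S" for i
    proof -
      have "norm (frame S ! i) = 1"
        using frame [OF S(2)] that by auto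
      then have "\<bar>t i\<bar> \<le> norm (chart S t - ?x)"
        using Cauchy_Schwarz_ineq2 [of "chart S t - ?x" "frame S ! i"] chart_component [OF S(2) that, of t]
        by simp
      also have "\<dots> \<le> diameter S"
        using diameter_bounded_bound [OF compact_imp_bounded [OF S(1)], of "chart S t" ?x] t x
        by (simp add: chart_domain_def dist_norm)
      finally show ?thesis .
    qed
    then show ?thesis
      using t by (auto simp: A_def chart_domain_def PiE_def abs_le_iff)
        (metis abs_le_D2 minus_le_iff)
  qed
  show ?thesis
    using A fin sub \<open>0 \<le> B\<close> B
    by (intro integrableI_bounded_set [of A _ _ B] meas AE_I2) (auto simp: indicator_def chart_domain_def)
qed

lemma continuous_on_eval_covec_wedge:
  assumes "continuous_on A \<eta>" "continuous_on A \<omega>"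
  shows "continuous_on A (\<lambda>x. eval_covec (wedge (\<eta> x) (\<omega> x)) vs)"
  by (rule bounded_linear.continuous_on [OF linear_eval_covec [THEN linear_conv_bounded_linear [THEN iffD1]]
        wedge.continuous_on [OF assms]])

lemma dof_add:
  assumes "compact F" "F \<noteq> {}" "continuous_on F \<eta>" "continuous_on F \<omega>" "continuous_on F \<zeta>"
  shows "dof F \<eta> (\<omega> + \<zeta>) = dof F \<eta> \<omega> + dof F \<eta> \<zeta>"
proof -
  have "continuous_on F (\<omega> + \<zeta>)"
    unfolding plus_fun_def by (intro continuous_on_add assms)
  then show ?thesis
    using assms integrable_chart [OF assms(1,2) continuous_on_eval_covec_wedge [OF assms(3,4)]]
      integrable_chart [OF assms(1,2) continuous_on_eval_covec_wedge [OF assms(3,5)]]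
    by (simp add: dof_def simplex_integral_def wedge.add_right linear_add [OF linear_eval_covec] distrib_left)
qed

lemma dof_scaleR:
  assumes "continuous_on F \<omega>"
  shows "dof F \<eta> (c *\<^sub>R \<omega>) = c * dof F \<eta> \<omega>"
proof -
  have "continuous_on F (c *\<^sub>R \<omega>)"
    unfolding scaleR_fun_def by (intro continuous_intros assms)
  moreover have "(LINT t|chart_measure F. indicator (chart_domain F) t *
        eval_covec (wedge (\<eta> (chart F t)) (c *\<^sub>R \<omega> (chart F t))) (frame F)) =
      (LINT t|chart_measure F. c * (indicator (chart_domain F) t *
        eval_covec (wedge (\<eta> (chart F t)) (\<omega> (chart F t))) (frame F)))"
    by (simp add: wedge.scaleR_right linear_scale [OF linear_eval_covec] mult.left_commute)
  ultimately show ?thesis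
    using assms by (simp add: dof_def simplex_integral_def scaleR_fun_def)
qed

text \<open>The frame vectors are tangent to \<open>F\<close>, so the integrand vanishes at every
  point of \<open>F\<close>. With linearity, a degree of freedom depends on the trace alone.\<close>

lemma dof_eq_0_of_trace_form:
  assumes "F \<noteq> {}" "trace_form F \<omega> = 0"
  shows "dof F \<eta> \<omega> = 0"
proof -
  have "eval_covec (wedge (\<eta> x) (\<omega> x)) (frame F) = 0" if "x \<in> F" for x
  proof (rule eval_covec_wedge_eq_0)
    show "eval_covec (\<omega> x) ws = 0" if "set ws \<subseteq> tangent F" for ws
      using fun_cong [OF fun_cong [OF assms(2), of x], of ws] \<open>x \<in> F\<close> that by (simp add: trace_form_def)
    show "set (frame F) \<subseteq> tangent F"
      using frame(5) [OF assms(1)] span_superset by blast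
  qed
  then have *: "indicator (chart_domain F) t * eval_covec (wedge (\<eta> (chart F t)) (\<omega> (chart F t))) (frame F) = 0" for t
    by (auto simp: indicator_def chart_domain_def)
  show ?thesis
    unfolding dof_def simplex_integral_def * by simp
qed

section \<open>Spaces of functionals and of bubbles\<close>

lemma linear_trace_form: "linear (trace_form S)"
  by (auto simp: linear_iff trace_form_def fun_eq_iff scaleR_fun_def
      linear_add [OF linear_eval_covec] linear_scale [OF linear_eval_covec])

lemma dof_space_cases:
  assumes "f \<in> dof_space fam r k F"
  obtains \<eta> where "f = dof F \<eta>" "\<And>A. continuous_on A \<eta>"
  using assms continuous_on_poly_forms continuous_on_trimmed_forms
  unfolding dof_space_def Let_def by (cases fam) (auto, blast+)

lemma fe_bubbles_subset_span:
  fixes S :: "('n::{finite,linorder}) point set"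
  shows "fe_bubbles fam r k S \<subseteq> span ((\<lambda>(\<alpha>, I). trace_form S (\<lambda>x. monomial \<alpha> x *\<^sub>R axis I 1)) `
    ({\<alpha>. sum \<alpha> UNIV \<le> r} \<times> UNIV))"
proof -
  let ?M = "(\<lambda>(\<alpha>, I) x. monomial \<alpha> x *\<^sub>R (axis I 1 :: 'n covec)) ` ({\<alpha>. sum \<alpha> UNIV \<le> r} \<times> UNIV)"
  have "fe_bubbles fam r k S \<subseteq> trace_form S ` fe_forms fam r k"
    by (auto simp: fe_bubbles_def)
  also have "\<dots> \<subseteq> trace_form S ` span ?M"
    using fe_forms_subset_poly_forms poly_forms_subset_span by (intro image_mono) blast
  also have "\<dots> = span (trace_form S ` ?M)"
    by (rule linear_span_image [OF linear_trace_form, symmetric])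
  finally show ?thesis
    by (simp add: image_image case_prod_beta)
qed

lemma dim_fe_bubbles_le:
  fixes S :: "('n::{finite,linorder}) point set"
  shows "dim (fe_bubbles fam r k S) \<le> card {\<alpha> :: 'n \<Rightarrow> nat. sum \<alpha> UNIV \<le> r} * CARD('n set)"
proof -
  have fin: "finite ({\<alpha> :: 'n \<Rightarrow> nat. sum \<alpha> UNIV \<le> r} \<times> (UNIV :: 'n set set))"
    using finite_multi_indices by (intro finite_cartesian_product) auto
  have "dim (fe_bubbles fam r k S) \<le> card ((\<lambda>(\<alpha>, I). trace_form S (\<lambda>x. monomial \<alpha> x *\<^sub>R axis I 1)) `
      ({\<alpha>. sum \<alpha> UNIV \<le> r} \<times> UNIV))"
    using fin by (intro real_vector.dim_le_card fe_bubbles_subset_span finite_imageI)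
  also have "\<dots> \<le> card ({\<alpha> :: 'n \<Rightarrow> nat. sum \<alpha> UNIV \<le> r} \<times> (UNIV :: 'n set set))"
    using fin by (rule card_image_le)
  finally show ?thesis
    by (simp add: card_cartesian_product)
qed


section \<open>Local reproduction\<close>

locale triangulated_domain =
  fixes \<T> :: "('n::{finite,linorder}) point set set" and \<Omega> :: "'n point set"
  assumes triangulates: "triangulates \<T> \<Omega>"
begin

lemma finite_triangulation: "finite \<T>"
  using triangulates by (simp add: triangulates_def simplicial_complex_def)

lemma simplex_nonempty: "S \<in> \<T> \<Longrightarrow> S \<noteq> {}"
  using triangulates by (auto simp: triangulates_def)

lemma simplex_obtain:
  assumes "S \<in> \<T>" obtains n where "n simplex S"
proof -
  have "\<exists>n. n simplex S"
    using triangulates assms by (simp add: triangulates_def simplicial_complex_def)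
  then show ?thesis using that by blast
qed

lemma compact_simplex: "S \<in> \<T> \<Longrightarrow> compact S"
  by (metis simplex_obtain Polytope.compact_simplex)

lemma convex_simplex: "S \<in> \<T> \<Longrightarrow> convex S"
  by (metis simplex_obtain Polytope.convex_simplex)

lemma face_in_triangulation: "S \<in> \<T> \<Longrightarrow> F face_of S \<Longrightarrow> F \<noteq> {} \<Longrightarrow> F \<in> \<T>"
  using triangulates by (auto simp: triangulates_def simplicial_complex_def)

text \<open>Two simplices of a complex meet in a common face, and here the intersection is
  \<open>S\<close>. This turns inclusion into the face relation needed for counting.\<close>

lemma subset_imp_face_of:
  assumes "S \<in> \<T>" "T \<in> \<T>" "S \<subseteq> T"
  shows "S face_of T"
proof -
  have "(T \<inter> S) face_of T"
    using triangulates assms unfolding triangulates_def simplicial_complex_def by blast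
  moreover have "T \<inter> S = S"
    using assms(3) by blast
  ultimately show ?thesis by simp
qed

lemma top_simplex_in: "T \<in> top_simplices \<T> \<Longrightarrow> T \<in> \<T>"
  by (simp add: top_simplices_def)

lemma obtain_top_simplex:
  assumes "S \<in> \<T>" obtains T where "T \<in> top_simplices \<T>" "S \<subseteq> T"
proof -
  have "\<exists>T\<in>top_simplices \<T>. S \<subseteq> T"
    using triangulates assms by (simp add: triangulates_def)
  then show ?thesis using that by blast
qed

lemma open_domain: "open \<Omega>"
  using triangulates by (auto simp: triangulates_def)

lemma sets_domain: "\<Omega> \<in> sets lebesgue"
  using open_domain by (simp add: borel_open)

lemma sets_top_simplex: "T \<in> top_simplices \<T> \<Longrightarrow> T \<in> sets lebesgue"
  using compact_simplex [OF top_simplex_in] by (simp add: borel_closed compact_imp_closed)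

lemma interior_top_simplex:
  assumes "T \<in> top_simplices \<T>"
  shows "interior T \<noteq> {}"
proof -
  have "rel_interior T \<noteq> {}"
    using assms by (simp add: rel_interior_eq_empty convex_simplex simplex_nonempty top_simplex_in)
  then show ?thesis
    using assms interior_rel_interior [of T] by (simp add: top_simplices_def)
qed

text \<open>\<open>T\<close> leaves the open domain only in its frontier, which is a null set by
  convexity. Norms over closed simplices and over the domain become comparable.\<close>

lemma AE_top_simplex_in_domain:
  assumes T: "T \<in> top_simplices \<T>"
  shows "AE x in lebesgue. x \<in> T \<longrightarrow> x \<in> \<Omega>"
proof -
  have "interior T \<subseteq> interior (\<Union>\<T>)"
    using top_simplex_in [OF T] by (intro interior_mono) blast
  then have "interior T \<subseteq> \<Omega>"
    using triangulates by (simp add: triangulates_def)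
  then have "T - \<Omega> \<subseteq> frontier T"
    using closure_subset [of T] by (auto simp: frontier_def)
  moreover have "negligible (frontier T)"
    by (intro negligible_convex_frontier convex_simplex top_simplex_in T)
  ultimately have "negligible (T - \<Omega>)"
    using negligible_subset by blast
  then have "AE x in lebesgue. x \<notin> T - \<Omega>"
    unfolding negligible_iff_null_sets by (rule AE_not_in)
  then show ?thesis
    by eventually_elim auto
qed

lemma tangent_top_simplex:
  assumes T: "T \<in> top_simplices \<T>"
  shows "tangent T = UNIV"
proof -
  have "dim (tangent T) = DIM('n point)"
    using T dim_tangent [OF simplex_nonempty [OF top_simplex_in [OF T]]]
    by (simp add: simplex_dim_def top_simplices_def)
  then have "span (tangent T) = UNIV"
    by (simp only: dim_eq_full)
  then show ?thesis
    unfolding tangent_def span_span .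
qed

text \<open>All vectors are tangent to a top-dimensional simplex, so there the trace is the form
  itself.\<close>

lemma trace_form_top_eq_0:
  assumes "T \<in> top_simplices \<T>" "trace_form T \<omega> = 0" "x \<in> T"
  shows "\<omega> x = 0"
proof -
  have "eval_covec (\<omega> x) vs = 0" for vs
    using fun_cong [OF fun_cong [OF assms(2), of x], of vs] assms(3)
    by (simp add: trace_form_def tangent_top_simplex [OF assms(1)])
  then show ?thesis
    using eval_covec_eq_0_iff by blast
qed

text \<open>Faces are hulls of subsets of the n + 1 vertices. The bound is the same for all
  triangulations.\<close>

lemma card_subsimplices:
  assumes T: "T \<in> top_simplices \<T>"
  shows "card {S \<in> \<T>. S \<subseteq> T} \<le> 2 ^ (CARD('n) + 1)"
proof -
  obtain m where m: "m simplex T"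
    using simplex_obtain [OF top_simplex_in [OF T]] .
  then have "m = int CARD('n)"
    using aff_dim_simplex [OF m] T by (simp add: top_simplices_def)
  then obtain C where C: "\<not> affine_dependent C" "int (card C) = int CARD('n) + 1" "T = convex hull C"
    using m by (auto simp: simplex_def)
  then have "finite C"
    by (simp add: aff_independent_finite)
  have "{S \<in> \<T>. S \<subseteq> T} \<subseteq> (\<lambda>c. convex hull c) ` Pow C"
    using subset_imp_face_of [OF _ top_simplex_in [OF T]] C
    by (fastforce simp: face_of_convex_hull_affine_independent)
  then have "card {S \<in> \<T>. S \<subseteq> T} \<le> card ((\<lambda>c. convex hull c) ` Pow C)"
    using \<open>finite C\<close> by (intro card_mono) simp_all
  also have "\<dots> \<le> card (Pow C)"
    using \<open>finite C\<close> by (intro card_image_le) simp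
  also have "\<dots> = 2 ^ (CARD('n) + 1)"
    using \<open>finite C\<close> C(2) by (simp add: card_Pow del: power_Suc)
  finally show ?thesis .
qed

section \<open>Patches\<close>

lemma finite_top_simplices: "finite (top_simplices \<T>)"
  using finite_triangulation by (simp add: top_simplices_def)

lemma sets_patch: "patch \<T> S \<in> sets lebesgue"
  unfolding patch_def using finite_top_simplices sets_top_simplex
  by (intro sets.finite_Union) auto

lemma sets_patch_star: "patch_star \<T> S \<in> sets lebesgue"
  unfolding patch_star_def using finite_top_simplices sets_top_simplex
  by (intro sets.finite_Union) auto

lemma subset_patch: "T \<in> top_simplices \<T> \<Longrightarrow> S \<subseteq> T \<Longrightarrow> T \<subseteq> patch \<T> S"
  by (auto simp: patch_def)

lemma interior_patch:
  assumes "S \<in> \<T>"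
  shows "interior (patch \<T> S) \<noteq> {}"
proof -
  obtain T where T: "T \<in> top_simplices \<T>" "S \<subseteq> T"
    using obtain_top_simplex [OF assms] .
  show ?thesis
    using interior_mono [OF subset_patch [OF T]] interior_top_simplex [OF T(1)] by auto
qed

lemma AE_patch_in_domain: "AE x in lebesgue. x \<in> patch \<T> S \<longrightarrow> x \<in> \<Omega>"
proof -
  have "AE x in lebesgue. \<forall>T\<in>top_simplices \<T>. x \<in> T \<longrightarrow> x \<in> \<Omega>"
    using AE_top_simplex_in_domain finite_top_simplices by (intro AE_finite_allI) auto
  then show ?thesis
    by eventually_elim (auto simp: patch_def)
qed

end

locale biorthogonal_basis = triangulated_domain \<T> \<Omega>
  for \<T> :: "('n::{finite,linorder}) point set set" and \<Omega> :: "'n point set" +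
  fixes C :: real and p :: ennreal and fam :: fe_family and r k :: nat
    and \<phi> :: "'n point set \<Rightarrow> nat \<Rightarrow> 'n dform"
    and \<phi>s :: "'n point set \<Rightarrow> nat \<Rightarrow> 'n dform \<Rightarrow> real"
  assumes biorthogonal: "biorthogonal_system C p fam r k \<T> \<Omega> \<phi> \<phi>s"
    and one_le_p: "1 \<le> p"
begin

abbreviation I :: "'n point set \<Rightarrow> nat set"
  where "I \<equiv> fe_index fam r k"

text \<open>\<open>\<phi> S i\<close> is fixed only up to null sets; its traces and degrees of
  freedom are those of this polynomial form on \<open>T\<close>.\<close>

definition basis_rep :: "'n point set \<Rightarrow> 'n point set \<Rightarrow> nat \<Rightarrow> 'n dform"
  where "basis_rep T S i = poly_rep k T (\<phi> S i)"

lemma basis_rep: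
  assumes "T \<in> top_simplices \<T>" "S \<in> \<T>" "i \<in> I S"
  shows "basis_rep T S i \<in> fe_forms fam r k" "ae_eq_on T (\<phi> S i) (basis_rep T S i)"
proof -
  have "\<forall>S\<in>\<T>. \<forall>i\<in>I S. \<phi> S i \<in> fe_space fam r k \<T> \<Omega>"
    using biorthogonal unfolding biorthogonal_system_def by (elim conjE)
  then have "\<phi> S i \<in> fe_space fam r k \<T> \<Omega>"
    using assms(2,3) by simp
  then obtain \<eta> where \<eta>: "\<eta> \<in> fe_forms fam r k" "ae_eq_on T (\<phi> S i) \<eta>"
    using assms(1) by (auto simp: fe_space_def)
  then have "basis_rep T S i = \<eta>"
    unfolding basis_rep_def
    using poly_rep_eqI [OF subsetD [OF fe_forms_subset_poly_forms] sets_top_simplex interior_top_simplex] assms(1)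
    by simp
  then show "basis_rep T S i \<in> fe_forms fam r k" "ae_eq_on T (\<phi> S i) (basis_rep T S i)"
    using \<eta> by simp_all
qed

lemma dof_basis_rep:
  assumes "T \<in> top_simplices \<T>" "S \<in> \<T>" "i \<in> I S" "S' \<in> \<T>" "j \<in> I S'" "S \<subseteq> T"
  shows "\<phi>s S i (basis_rep T S' j) = (if (S, i) = (S', j) then 1 else 0)"
proof -
  have "\<forall>S\<in>\<T>. \<forall>i\<in>I S. \<forall>S'\<in>\<T>. \<forall>j\<in>I S'. \<forall>T\<in>top_simplices \<T>. S \<subseteq> T \<longrightarrow>
        \<phi>s S i (poly_rep k T (\<phi> S' j)) = (if (S, i) = (S', j) then 1 else 0)"
    using biorthogonal unfolding biorthogonal_system_def by (elim conjE)
  then show ?thesis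
    using assms by (simp add: basis_rep_def)
qed

lemma trace_basis_rep:
  assumes "T \<in> top_simplices \<T>" "S \<in> \<T>" "i \<in> I S" "S' \<in> \<T>" "S' \<subseteq> T" "\<not> S \<subseteq> S'"
  shows "trace_form S' (basis_rep T S i) = 0"
proof -
  have "\<forall>S\<in>\<T>. \<forall>i\<in>I S. \<forall>S'\<in>\<T>. \<not> S \<subseteq> S' \<longrightarrow>
      (\<forall>T\<in>top_simplices \<T>. S' \<subseteq> T \<longrightarrow> trace_form S' (poly_rep k T (\<phi> S i)) = 0)"
    using biorthogonal unfolding biorthogonal_system_def by (elim conjE)
  then show ?thesis
    using assms by (simp add: basis_rep_def)
qed

text \<open>The trace condition of the biorthogonal system is applied with \<open>T\<close> itself
  as the simplex that does not contain \<open>S\<close>.\<close>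

lemma basis_rep_eq_0:
  assumes "T \<in> top_simplices \<T>" "S \<in> \<T>" "i \<in> I S" "\<not> S \<subseteq> T" "x \<in> T"
  shows "basis_rep T S i x = 0"
  using trace_form_top_eq_0 [OF assms(1) trace_basis_rep assms(5)] assms top_simplex_in by blast

section \<open>Linearity of the functionals on polynomial forms\<close>

lemma dof_obtain:
  assumes "S \<in> \<T>" "i \<in> I S"
  obtains \<eta> where "\<phi>s S i = dof S \<eta>" "\<And>A. continuous_on A \<eta>"
proof -
  have "\<forall>S\<in>\<T>. inj_on (\<phi>s S) (I S) \<and> independent (\<phi>s S ` I S) \<and>
      span (\<phi>s S ` I S) = dof_space fam r k S"
    using biorthogonal unfolding biorthogonal_system_def by (elim conjE)
  then have "span (\<phi>s S ` I S) = dof_space fam r k S"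
    using assms(1) by simp
  then have "\<phi>s S i \<in> dof_space fam r k S"
    using assms(2) span_base [of "\<phi>s S i" "\<phi>s S ` I S"] by simp
  then show ?thesis
    by (rule dof_space_cases) (rule that)
qed

lemma fe_forms_poly: "\<omega> \<in> fe_forms fam r k \<Longrightarrow> \<omega> \<in> poly_forms (int r) (int k)"
  using fe_forms_subset_poly_forms by blast

text \<open>Additivity is confined to polynomial forms: \<open>dof\<close> is 0 by convention on
  forms that are discontinuous on the simplex, and a sum of two such forms may be
  continuous.\<close>

lemma dof_plus:
  assumes "S \<in> \<T>" "i \<in> I S" "\<omega> \<in> poly_forms (int r) (int k)" "\<zeta> \<in> poly_forms (int r) (int k)"
  shows "\<phi>s S i (\<omega> + \<zeta>) = \<phi>s S i \<omega> + \<phi>s S i \<zeta>"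
proof -
  obtain \<eta> where "\<phi>s S i = dof S \<eta>" "\<And>A. continuous_on A \<eta>"
    by (rule dof_obtain [OF assms(1,2)]) blast
  then show ?thesis
    using dof_add [OF compact_simplex simplex_nonempty] assms continuous_on_poly_forms by metis
qed

lemma dof_scale:
  assumes "S \<in> \<T>" "i \<in> I S" "\<omega> \<in> poly_forms (int r) (int k)"
  shows "\<phi>s S i (c *\<^sub>R \<omega>) = c * \<phi>s S i \<omega>"
proof -
  obtain \<eta> where "\<phi>s S i = dof S \<eta>" "\<And>A. continuous_on A \<eta>"
    by (rule dof_obtain [OF assms(1,2)]) blast
  then show ?thesis
    using dof_scaleR assms continuous_on_poly_forms by metis
qed

lemma dof_diff:
  assumes "S \<in> \<T>" "i \<in> I S" "\<omega> \<in> poly_forms (int r) (int k)" "\<zeta> \<in> poly_forms (int r) (int k)"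
  shows "\<phi>s S i (\<omega> - \<zeta>) = \<phi>s S i \<omega> - \<phi>s S i \<zeta>"
  using dof_plus [OF assms(1,2) subspace_diff [OF subspace_poly_forms assms(3,4)] assms(4)] by simp

lemma dof_sum:
  assumes "S \<in> \<T>" "i \<in> I S" "\<And>j. j \<in> J \<Longrightarrow> f j \<in> poly_forms (int r) (int k)"
  shows "\<phi>s S i (\<Sum>j\<in>J. c j *\<^sub>R f j) = (\<Sum>j\<in>J. c j * \<phi>s S i (f j))"
  using assms(3)
proof (induction J rule: infinite_finite_induct)
  case (insert j J)
  have "(\<Sum>j\<in>J. c j *\<^sub>R f j) \<in> poly_forms (int r) (int k)"
    using insert.prems by (intro subspace_sum subspace_scale subspace_poly_forms) auto
  moreover have "c j *\<^sub>R f j \<in> poly_forms (int r) (int k)"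
    using insert.prems by (intro subspace_scale subspace_poly_forms) auto
  ultimately have "\<phi>s S i (c j *\<^sub>R f j + (\<Sum>j\<in>J. c j *\<^sub>R f j)) =
      \<phi>s S i (c j *\<^sub>R f j) + \<phi>s S i (\<Sum>j\<in>J. c j *\<^sub>R f j)"
    using assms(1,2) by (intro dof_plus)
  moreover have "\<phi>s S i (c j *\<^sub>R f j) = c j * \<phi>s S i (f j)"
    using insert.prems by (intro dof_scale assms(1,2)) auto
  moreover have "\<phi>s S i (\<Sum>j\<in>J. c j *\<^sub>R f j) = (\<Sum>j\<in>J. c j * \<phi>s S i (f j))"
    using insert.prems by (intro insert.IH) auto
  ultimately show ?case
    by (simp only: sum.insert [OF insert.hyps])
qed (use dof_scale [OF assms(1,2) subspace_0 [OF subspace_poly_forms], of 0] in simp_all)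

lemma dof_eq_0_of_trace:
  assumes "S \<in> \<T>" "i \<in> I S" "trace_form S \<omega> = 0"
  shows "\<phi>s S i \<omega> = 0"
proof -
  obtain \<eta> where "\<phi>s S i = dof S \<eta>"
    by (rule dof_obtain [OF assms(1,2)]) blast
  then show ?thesis
    using dof_eq_0_of_trace_form [OF simplex_nonempty] assms by metis
qed

section \<open>Bubbles and unisolvence\<close>

lemma finite_index: "finite (I S)"
  by (simp add: fe_index_def)

lemma bubble_eq_sum_basis:
  assumes T: "T \<in> top_simplices \<T>" and F: "F \<in> \<T>" "F \<subseteq> T" and \<beta>: "\<beta> \<in> fe_bubbles fam r k F"
  obtains c where "\<beta> = trace_form F (\<Sum>i\<in>I F. c i *\<^sub>R basis_rep T F i)"
proof -
  let ?f = "\<lambda>i. trace_form F (basis_rep T F i)"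
  obtain W where W: "finite W" "fe_bubbles fam r k F \<subseteq> span W"
    using fe_bubbles_subset_span finite_multi_indices by (metis finite_SigmaI finite_imageI finite)
  have tr: "trace_form F (\<Sum>i\<in>I F. c i *\<^sub>R basis_rep T F i) = (\<Sum>i\<in>I F. c i *\<^sub>R ?f i)" for c
    by (simp add: linear_sum [OF linear_trace_form] linear_scale [OF linear_trace_form])
  have "\<exists>c. \<beta> = (\<Sum>i\<in>I F. c i *\<^sub>R ?f i)"
  proof (rule finite_dim_independent_family_spans [OF W _ finite_index _ _ \<beta>])
    fix i assume i: "i \<in> I F"
    have "trace_form G (basis_rep T F i) = 0" if "G face_of F" "G \<noteq> {}" "G \<noteq> F" for G
    proof (rule trace_basis_rep [OF T F(1) i])
      show "G \<in> \<T>"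
        using face_in_triangulation [OF F(1)] that by blast
      show "G \<subseteq> T" "\<not> F \<subseteq> G"
        using face_of_imp_subset [OF that(1)] F(2) that(3) by auto
    qed
    then show "?f i \<in> fe_bubbles fam r k F"
      using basis_rep(1) [OF T F(1) i] by (auto simp: fe_bubbles_def)
  next
    \<comment> \<open>The index set is defined to have this size; the dimension count enters
      here.\<close>
    show "card (I F) = dim (fe_bubbles fam r k F)"
      by (simp add: fe_index_def)
  next
    fix c i assume c: "(\<Sum>i\<in>I F. c i *\<^sub>R ?f i) = 0" and i: "i \<in> I F"
    \<comment> \<open>The combination of forms itself need not vanish, but its trace on
      \<open>F\<close> does, and the functional sees nothing else. Biorthogonality then leaves only
      \<open>c i\<close>.\<close>
    have "0 = \<phi>s F i (\<Sum>i\<in>I F. c i *\<^sub>R basis_rep T F i)"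
      using dof_eq_0_of_trace [OF F(1) i] c tr by simp
    also have "\<dots> = (\<Sum>j\<in>I F. c j * \<phi>s F i (basis_rep T F j))"
      by (intro dof_sum F i fe_forms_poly basis_rep T)
    also have "\<dots> = (\<Sum>j\<in>I F. if j = i then c j else 0)"
      using T F i by (intro sum.cong) (auto simp: dof_basis_rep)
    also have "\<dots> = c i"
      using i finite_index by simp
    finally show "c i = 0" by simp
  qed
  then show ?thesis
    using that tr by metis
qed

lemma unisolvence:
  assumes T: "T \<in> top_simplices \<T>" and \<rho>: "\<rho> \<in> fe_forms fam r k"
    and 0: "\<And>S i. S \<in> \<T> \<Longrightarrow> S \<subseteq> T \<Longrightarrow> i \<in> I S \<Longrightarrow> \<phi>s S i \<rho> = 0"
    and x: "x \<in> T"
  shows "\<rho> x = 0"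
proof -
  have "trace_form F \<rho> = 0" if "F \<in> \<T>" "F \<subseteq> T" for F
    using that
  \<comment> \<open>Vertices need no base case: they have no nonempty proper faces, so their traces
    are bubbles at once.\<close>
  proof (induction "nat (aff_dim F)" arbitrary: F rule: less_induct)
    case less
    have "trace_form G \<rho> = 0" if G: "G face_of F" "G \<noteq> {}" "G \<noteq> F" for G
    proof (rule less.hyps)
      show "G \<in> \<T>"
        using face_in_triangulation [OF less.prems(1)] G by blast
      show "G \<subseteq> T"
        using face_of_imp_subset [OF G(1)] less.prems(2) by blast
      have "aff_dim G < aff_dim F"
        using face_of_aff_dim_lt [OF convex_simplex [OF less.prems(1)] G(1,3)] .
      \<comment> \<open>Only for nonempty \<open>G\<close> does \<open>nat\<close> preserve
        strictness: the dimension -1 of the empty set and the dimension 0 of a vertex have the same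
        image.\<close>
      then show "nat (aff_dim G) < nat (aff_dim F)"
        using aff_dim_negative_iff [of G] G(2) by linarith
    qed
    then have "trace_form F \<rho> \<in> fe_bubbles fam r k F"
      using \<rho> by (auto simp: fe_bubbles_def)
    then obtain c where c: "trace_form F \<rho> = trace_form F (\<Sum>i\<in>I F. c i *\<^sub>R basis_rep T F i)"
      by (rule bubble_eq_sum_basis [OF T less.prems])
    let ?\<sigma> = "\<Sum>i\<in>I F. c i *\<^sub>R basis_rep T F i"
    have \<sigma>: "?\<sigma> \<in> poly_forms (int r) (int k)"
      using T less.prems by (intro subspace_sum subspace_scale subspace_poly_forms fe_forms_poly basis_rep)
    \<comment> \<open>Both forms have the same trace on \<open>F\<close>, hence the same value under
      \<open>\<phi>s F i\<close>: zero by hypothesis for \<open>\<rho>\<close>, and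
      \<open>c i\<close> for the combination.\<close>
    have "c i = 0" if i: "i \<in> I F" for i
    proof -
      have "trace_form F (\<rho> - ?\<sigma>) = 0"
        using c by (simp add: linear_diff [OF linear_trace_form])
      then have "\<phi>s F i \<rho> - \<phi>s F i ?\<sigma> = 0"
        using dof_eq_0_of_trace [OF less.prems(1) i] dof_diff [OF less.prems(1) i fe_forms_poly [OF \<rho>] \<sigma>] by simp
      moreover have "\<phi>s F i ?\<sigma> = (\<Sum>j\<in>I F. c j * \<phi>s F i (basis_rep T F j))"
        by (intro dof_sum less.prems i fe_forms_poly basis_rep T)
      moreover have "\<dots> = (\<Sum>j\<in>I F. if j = i then c j else 0)"
        using T less.prems i by (intro sum.cong) (auto simp: dof_basis_rep)
      moreover have "\<dots> = c i"
        using i finite_index by simp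
      ultimately show ?thesis
        using 0 [OF less.prems i] by simp
    qed
    then have "?\<sigma> = 0"
      by simp
    then show ?case
      using c by (simp add: linear_0 [OF linear_trace_form])
  qed
  then show ?thesis
    using trace_form_top_eq_0 [OF T _ x] top_simplex_in [OF T] by blast
qed

text \<open>By biorthogonality both sides have the same degrees of freedom on all subsimplices of
  \<open>T\<close>, so unisolvence applies to their difference.\<close>

lemma local_reproduction:
  assumes T: "T \<in> top_simplices \<T>" and \<psi>: "\<psi> \<in> fe_forms fam r k" and x: "x \<in> T"
  shows "\<psi> x = (\<Sum>S\<in>{S\<in>\<T>. S \<subseteq> T}. \<Sum>i\<in>I S. \<phi>s S i \<psi> *\<^sub>R basis_rep T S i x)"
proof -
  let ?A = "Sigma {S\<in>\<T>. S \<subseteq> T} I"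
  define \<sigma> where "\<sigma> = (\<Sum>a\<in>?A. \<phi>s (fst a) (snd a) \<psi> *\<^sub>R basis_rep T (fst a) (snd a))"
  have fin: "finite ?A"
    using finite_triangulation finite_index by auto
  have \<sigma>: "\<sigma> \<in> fe_forms fam r k"
    unfolding \<sigma>_def using T
    by (intro subspace_sum subspace_scale subspace_fe_forms basis_rep) auto
  have "\<phi>s S i (\<psi> - \<sigma>) = 0" if S: "S \<in> \<T>" "S \<subseteq> T" "i \<in> I S" for S i
  proof -
    have "\<phi>s S i \<sigma> = (\<Sum>a\<in>?A. \<phi>s (fst a) (snd a) \<psi> * \<phi>s S i (basis_rep T (fst a) (snd a)))"
      unfolding \<sigma>_def using S T by (intro dof_sum fe_forms_poly basis_rep) auto
    also have "\<dots> = (\<Sum>a\<in>?A. if a = (S, i) then \<phi>s S i \<psi> else 0)"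
      using S T by (intro sum.cong) (auto simp: dof_basis_rep split: if_splits)
    also have "\<dots> = \<phi>s S i \<psi>"
      using S fin by simp
    finally show ?thesis
      using dof_diff [OF S(1,3) fe_forms_poly [OF \<psi>] fe_forms_poly [OF \<sigma>]] by simp
  qed
  from unisolvence [OF T subspace_diff [OF subspace_fe_forms \<psi> \<sigma>] this x]
  have "\<psi> x = \<sigma> x"
    by simp
  also have "\<dots> = (\<Sum>S\<in>{S\<in>\<T>. S \<subseteq> T}. \<Sum>i\<in>I S. \<phi>s S i \<psi> *\<^sub>R basis_rep T S i x)"
    unfolding \<sigma>_def using finite_triangulation finite_index
    by (simp add: sum_fun_apply scaleR_fun_def sum.Sigma case_prod_beta)
  finally show ?thesis .
qed

end


section \<open>Estimates for the interpolant\<close>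

lemma borel_measurable_poly_forms:
  "\<omega> \<in> poly_forms r k \<Longrightarrow> U \<in> sets lebesgue \<Longrightarrow> \<omega> \<in> borel_measurable (lebesgue_on U)"
  by (intro continuous_imp_measurable_on_sets_lebesgue continuous_on_poly_forms)

lemma ennreal_mono_mult: "a \<le> b \<Longrightarrow> x \<le> y \<Longrightarrow> ennreal a * x \<le> ennreal b * y"
  by (intro mult_mono ennreal_leI) auto

locale clement_setting = biorthogonal_basis \<T> \<Omega> C p fam r k \<phi> \<phi>s
  for \<T> :: "('n::{finite,linorder}) point set set" and \<Omega> :: "'n point set"
    and C :: real and p :: ennreal and fam :: fe_family and r k :: nat
    and \<phi> :: "'n point set \<Rightarrow> nat \<Rightarrow> 'n dform"
    and \<phi>s :: "'n point set \<Rightarrow> nat \<Rightarrow> 'n dform \<Rightarrow> real" +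
  fixes C' :: real and P :: "'n point set \<Rightarrow> 'n dform \<Rightarrow> 'n dform"
  assumes projections: "patch_projections C' p r k \<T> \<Omega> P"
begin

abbreviation clement :: "'n dform \<Rightarrow> 'n dform"
  where "clement \<equiv> clement_interpolant fam r k \<T> \<phi> \<phi>s P"

definition proj_rep :: "'n point set \<Rightarrow> 'n dform \<Rightarrow> 'n dform"
  where "proj_rep S \<omega> = poly_rep k (patch \<T> S) (P S \<omega>)"

text \<open>The constant of the theorem may not depend on \<open>k\<close>, so spaces of bubbles are compared with the
  polynomial forms of all form degrees together.\<close>

definition local_dim_bound :: nat
  where "local_dim_bound =
    2 ^ (CARD('n) + 1) * (card {\<alpha> :: 'n \<Rightarrow> nat. sum \<alpha> UNIV \<le> r} * CARD('n set))"

lemma sum_subsimplices_const_le: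
  fixes X :: ennreal
  assumes T: "T \<in> top_simplices \<T>"
  shows "(\<Sum>S\<in>{S\<in>\<T>. S \<subseteq> T}. \<Sum>i\<in>I S. X) \<le> ennreal (real local_dim_bound) * X"
proof -
  let ?A = "{S\<in>\<T>. S \<subseteq> T}"
  let ?d = "card {\<alpha> :: 'n \<Rightarrow> nat. sum \<alpha> UNIV \<le> r} * CARD('n set)"
  have "(\<Sum>S\<in>?A. card (I S)) \<le> (\<Sum>S\<in>?A. ?d)"
    using dim_fe_bubbles_le [of fam r k] by (intro sum_mono) (simp add: fe_index_def)
  also have "\<dots> = card ?A * ?d"
    by simp
  also have "\<dots> \<le> local_dim_bound"
    unfolding local_dim_bound_def by (intro mult_right_mono card_subsimplices T) simp
  finally have le: "(\<Sum>S\<in>?A. card (I S)) \<le> local_dim_bound" .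
  have "(\<Sum>S\<in>?A. \<Sum>i\<in>I S. X) = of_nat (\<Sum>S\<in>?A. card (I S)) * X"
    by (simp add: sum_distrib_right)
  also have "\<dots> \<le> of_nat local_dim_bound * X"
    using le by (intro mult_right_mono of_nat_mono) auto
  finally show ?thesis
    by (simp add: ennreal_of_nat_eq_real_of_nat)
qed

text \<open>Inclusion in the domain is asked for only up to a null set, since closed simplices and
  patches may reach its boundary.\<close>

lemma Lp_forms_restrict:
  assumes "\<omega> \<in> Lp_forms p k \<Omega>" "U \<in> sets lebesgue" "AE x in lebesgue. x \<in> U \<longrightarrow> x \<in> \<Omega>"
  shows "\<omega> \<in> Lp_forms p k U"
proof -
  have meas: "\<omega> \<in> borel_measurable (lebesgue_on \<Omega>)" and fin: "Lp_norm p \<Omega> \<omega> < \<infinity>"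
    and cov: "AE x in lebesgue_on \<Omega>. \<omega> x \<in> covectors k"
    using assms(1) by (auto simp: Lp_forms_def)
  have AE: "AE x in lebesgue. x \<in> U \<longrightarrow> \<omega> x = (if x \<in> \<Omega> then \<omega> x else 0)"
    using assms(3) by eventually_elim auto
  have "AE x in lebesgue. x \<in> \<Omega> \<longrightarrow> \<omega> x \<in> covectors k"
    using cov sets_domain by (subst (asm) AE_restrict_space_iff) auto
  with assms(3) have "AE x in lebesgue. x \<in> U \<longrightarrow> \<omega> x \<in> covectors k"
    by eventually_elim auto
  then have "AE x in lebesgue_on U. \<omega> x \<in> covectors k"
    using assms(2) by (subst AE_restrict_space_iff) auto
  moreover have "\<omega> \<in> borel_measurable (lebesgue_on U)"
    by (rule borel_measurable_lebesgue_on_AE [OF meas sets_domain assms(2) AE])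
  moreover have "Lp_norm p U \<omega> < \<infinity>"
    using Lp_norm_mono_AE [OF one_le_p meas sets_domain assms(2) AE] fin by (rule le_less_trans)
  ultimately show ?thesis
    by (simp add: Lp_forms_def)
qed

lemma projection_Lp_forms:
  assumes "S \<in> \<T>" "\<omega> \<in> Lp_forms p k \<Omega>"
  shows "P S \<omega> \<in> Lp_forms p k \<Omega>"
proof -
  have "Lp_bounded_linear p k \<Omega> (P S)"
    using projections assms(1) by (simp add: patch_projections_def)
  then show ?thesis
    using assms(2) by (simp add: Lp_bounded_linear_def)
qed

text \<open>The polynomial form given for \<open>P S \<omega>\<close> is prescribed on the open
  domain, the representative on the closed patch; the part of the patch outside the domain is
  null.\<close>

lemma proj_rep:
  assumes S: "S \<in> \<T>" and \<omega>: "\<omega> \<in> Lp_forms p k \<Omega>"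
  shows "proj_rep S \<omega> \<in> poly_forms (int r) (int k)"
    and "AE x in lebesgue. x \<in> patch \<T> S \<longrightarrow> P S \<omega> x = proj_rep S \<omega> x"
proof -
  have "\<exists>\<eta>\<in>poly_forms (int r) (int k). ae_eq_on \<Omega> (P S \<omega>) (\<lambda>x. if x \<in> patch \<T> S then \<eta> x else 0)"
    using projections S \<omega> by (simp add: patch_projections_def)
  then obtain \<eta> where \<eta>: "\<eta> \<in> poly_forms (int r) (int k)"
    "ae_eq_on \<Omega> (P S \<omega>) (\<lambda>x. if x \<in> patch \<T> S then \<eta> x else 0)"
    by blast
  have "AE x in lebesgue. x \<in> \<Omega> \<longrightarrow> P S \<omega> x = (if x \<in> patch \<T> S then \<eta> x else 0)"
    using \<eta>(2) by (simp add: ae_eq_on_iff [OF sets_domain])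
  with AE_patch_in_domain [of S]
  have AE: "AE x in lebesgue. x \<in> patch \<T> S \<longrightarrow> P S \<omega> x = \<eta> x"
    by eventually_elim auto
  then have "proj_rep S \<omega> = \<eta>"
    unfolding proj_rep_def
    by (intro poly_rep_eqI [OF \<eta>(1) sets_patch interior_patch [OF S]]) (simp add: ae_eq_on_iff [OF sets_patch])
  then show "proj_rep S \<omega> \<in> poly_forms (int r) (int k)"
    "AE x in lebesgue. x \<in> patch \<T> S \<longrightarrow> P S \<omega> x = proj_rep S \<omega> x"
    using \<eta>(1) AE by simp_all
qed

lemma proj_error_le:
  assumes T: "T \<in> top_simplices \<T>" and S: "S \<in> \<T>" "S \<subseteq> T" and \<omega>: "\<omega> \<in> Lp_forms p k \<Omega>"
  shows "Lp_norm p T (\<lambda>x. \<omega> x - proj_rep S \<omega> x) \<le> Lp_norm p (patch \<T> S) (\<omega> - P S \<omega>)"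
proof (rule Lp_norm_mono_AE [OF one_le_p _ sets_patch sets_top_simplex [OF T]])
  have "\<omega> \<in> borel_measurable (lebesgue_on (patch \<T> S))" "P S \<omega> \<in> borel_measurable (lebesgue_on (patch \<T> S))"
    using Lp_forms_restrict [OF _ sets_patch AE_patch_in_domain] \<omega> projection_Lp_forms [OF S(1) \<omega>]
    by (auto simp: Lp_forms_def)
  then show "\<omega> - P S \<omega> \<in> borel_measurable (lebesgue_on (patch \<T> S))"
    unfolding fun_diff_def by (rule borel_measurable_diff)
  show "AE x in lebesgue. x \<in> T \<longrightarrow>
      \<omega> x - proj_rep S \<omega> x = (if x \<in> patch \<T> S then (\<omega> - P S \<omega>) x else 0)"
    using proj_rep(2) [OF S(1) \<omega>] subset_patch [OF T S(2)] by (auto elim!: eventually_mono)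
qed

lemma proj_stable:
  assumes S: "S \<in> \<T>" and \<omega>: "\<omega> \<in> Lp_forms p k \<Omega>"
  shows "Lp_norm p (patch \<T> S) (\<omega> - P S \<omega>) \<le> ennreal \<bar>C'\<bar> * Lp_norm p (interior (patch \<T> S)) \<omega>"
proof -
  have "\<forall>m\<in>{0..real r + 1}. \<forall>\<omega>\<in>sobolev_forms p m k \<Omega>.
      Lp_norm p (patch \<T> S) (\<omega> - P S \<omega>) \<le>
        ennreal (C' * mesh_size \<T> S powr m) * sobolev_seminorm p m (interior (patch \<T> S)) \<omega>"
    using projections S unfolding patch_projections_def by blast
  then have "Lp_norm p (patch \<T> S) (\<omega> - P S \<omega>) \<le>
      ennreal (C' * mesh_size \<T> S powr 0) * sobolev_seminorm p 0 (interior (patch \<T> S)) \<omega>"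
    using sobolev_forms_0 [OF one_le_p \<omega> sets_domain] by force
  \<comment> \<open>\<open>powr 0\<close> gives 1, or 0 for base 0, and \<open>C'\<close> may have
    any sign; the absolute value covers every case.\<close>
  also have "\<dots> \<le> ennreal \<bar>C'\<bar> * Lp_norm p (interior (patch \<T> S)) \<omega>"
    by (intro ennreal_mono_mult) (auto simp: sobolev_seminorm_0)
  finally show ?thesis .
qed

lemma basis_term_le:
  assumes T: "T \<in> top_simplices \<T>" and S: "S \<in> \<T>" "S \<subseteq> T" and i: "i \<in> I S"
    and \<zeta>: "\<zeta> \<in> poly_forms (int r) (int k)"
  shows "Lp_norm p T (\<lambda>x. \<phi>s S i \<zeta> *\<^sub>R basis_rep T S i x) \<le> ennreal \<bar>C\<bar> * Lp_norm p T \<zeta>"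
proof -
  have AE: "AE x in lebesgue. x \<in> T \<longrightarrow> \<phi> S i x = basis_rep T S i x"
    using basis_rep(2) [OF T S(1) i] by (simp add: ae_eq_on_iff [OF sets_top_simplex [OF T]])
  have "basis_rep T S i \<in> borel_measurable (lebesgue_on T)"
    by (intro borel_measurable_poly_forms [OF fe_forms_poly] basis_rep sets_top_simplex T S i)
  then have "\<phi> S i \<in> borel_measurable (lebesgue_on T)"
    by (rule borel_measurable_lebesgue_on_AE [OF _ sets_top_simplex [OF T] sets_top_simplex [OF T]])
      (use AE in \<open>auto elim!: eventually_mono\<close>)
  then have "(\<lambda>x. \<phi>s S i \<zeta> *\<^sub>R \<phi> S i x) \<in> borel_measurable (lebesgue_on T)"
    by measurable
  then have "Lp_norm p T (\<lambda>x. \<phi>s S i \<zeta> *\<^sub>R basis_rep T S i x) \<le> Lp_norm p T (\<lambda>x. \<phi>s S i \<zeta> *\<^sub>R \<phi> S i x)"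
    by (rule Lp_norm_mono_AE [OF one_le_p _ sets_top_simplex [OF T] sets_top_simplex [OF T]])
      (use AE in \<open>auto elim!: eventually_mono\<close>)
  also have "\<dots> \<le> ennreal C * Lp_norm p T \<zeta>"
  proof -
    have "\<forall>S\<in>\<T>. \<forall>i\<in>I S. \<forall>T\<in>top_simplices \<T>. S \<subseteq> T \<longrightarrow>
      Lp_norm p T (\<phi> S i) \<le>
        ennreal (C * mesh_size \<T> S powr (real CARD('n) * inv_exponent p - real k)) \<and>
      (\<forall>\<omega>\<in>poly_forms (int r) (int k).
        Lp_norm p T (\<lambda>x. \<phi>s S i \<omega> *\<^sub>R \<phi> S i x) \<le> ennreal C * Lp_norm p T \<omega>)"
      using biorthogonal unfolding biorthogonal_system_def by (elim conjE)
    then show ?thesis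
      using T S i \<zeta> by blast
  qed
  \<comment> \<open>\<open>ennreal\<close> truncates negative reals to 0, so the absolute value only
    enlarges the bound, and nonnegative constants can later be multiplied under
    \<open>ennreal\<close>.\<close>
  also have "\<dots> \<le> ennreal \<bar>C\<bar> * Lp_norm p T \<zeta>"
    by (intro ennreal_mono_mult) auto
  finally show ?thesis .
qed

lemma clement_AE:
  assumes T: "T \<in> top_simplices \<T>" and \<omega>: "\<omega> \<in> Lp_forms p k \<Omega>"
  shows "AE x in lebesgue. x \<in> T \<longrightarrow>
    clement \<omega> x = (\<Sum>S\<in>{S\<in>\<T>. S \<subseteq> T}. \<Sum>i\<in>I S. \<phi>s S i (proj_rep S \<omega>) *\<^sub>R basis_rep T S i x)"
proof -
  have "AE x in lebesgue. \<forall>S\<in>\<T>. \<forall>i\<in>I S. x \<in> T \<longrightarrow> \<phi> S i x = basis_rep T S i x"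
    using basis_rep(2) [OF T] finite_triangulation finite_index
    by (intro AE_finite_allI) (auto simp: ae_eq_on_iff [OF sets_top_simplex [OF T]])
  then show ?thesis
  proof eventually_elim
    case (elim x)
    show ?case
    proof
      assume x: "x \<in> T"
      have "clement \<omega> x = (\<Sum>S\<in>\<T>. \<Sum>i\<in>I S. \<phi>s S i (proj_rep S \<omega>) *\<^sub>R basis_rep T S i x)"
        unfolding clement_interpolant_def proj_rep_def using elim x by (intro sum.cong) auto
      also have "\<dots> = (\<Sum>S\<in>{S\<in>\<T>. S \<subseteq> T}. \<Sum>i\<in>I S. \<phi>s S i (proj_rep S \<omega>) *\<^sub>R basis_rep T S i x)"
        using finite_triangulation basis_rep_eq_0 [OF T _ _ _ x]
        by (intro sum.mono_neutral_right) (auto intro!: sum.neutral)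
      finally show "clement \<omega> x = \<dots>" .
    qed
  qed
qed

lemma Lp_norm_basis_sum_le:
  assumes T: "T \<in> top_simplices \<T>" and \<zeta>: "\<And>S. S \<in> \<T> \<Longrightarrow> S \<subseteq> T \<Longrightarrow> \<zeta> S \<in> poly_forms (int r) (int k)"
  shows "(\<lambda>x. \<Sum>S\<in>{S\<in>\<T>. S \<subseteq> T}. \<Sum>i\<in>I S. \<phi>s S i (\<zeta> S) *\<^sub>R basis_rep T S i x) \<in> borel_measurable (lebesgue_on T)"
    and "Lp_norm p T (\<lambda>x. \<Sum>S\<in>{S\<in>\<T>. S \<subseteq> T}. \<Sum>i\<in>I S. \<phi>s S i (\<zeta> S) *\<^sub>R basis_rep T S i x) \<le>
      (\<Sum>S\<in>{S\<in>\<T>. S \<subseteq> T}. \<Sum>i\<in>I S. ennreal \<bar>C\<bar> * Lp_norm p T (\<zeta> S))"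
proof -
  have meas: "(\<lambda>x. \<phi>s S i (\<zeta> S) *\<^sub>R basis_rep T S i x) \<in> borel_measurable (lebesgue_on T)"
    if "S \<in> \<T>" "i \<in> I S" for S i
    by (intro borel_measurable_scaleR borel_measurable_const borel_measurable_poly_forms [OF fe_forms_poly]
        basis_rep sets_top_simplex T that)
  then show "(\<lambda>x. \<Sum>S\<in>{S\<in>\<T>. S \<subseteq> T}. \<Sum>i\<in>I S. \<phi>s S i (\<zeta> S) *\<^sub>R basis_rep T S i x) \<in> borel_measurable (lebesgue_on T)"
    by (intro borel_measurable_sum) auto
  have "Lp_norm p T (\<lambda>x. \<Sum>S\<in>{S\<in>\<T>. S \<subseteq> T}. \<Sum>i\<in>I S. \<phi>s S i (\<zeta> S) *\<^sub>R basis_rep T S i x) \<le>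
      (\<Sum>S\<in>{S\<in>\<T>. S \<subseteq> T}. Lp_norm p T (\<lambda>x. \<Sum>i\<in>I S. \<phi>s S i (\<zeta> S) *\<^sub>R basis_rep T S i x))"
    using meas by (intro Lp_norm_sum one_le_p borel_measurable_sum) auto
  also have "\<dots> \<le> (\<Sum>S\<in>{S\<in>\<T>. S \<subseteq> T}. \<Sum>i\<in>I S. Lp_norm p T (\<lambda>x. \<phi>s S i (\<zeta> S) *\<^sub>R basis_rep T S i x))"
    using meas by (intro sum_mono Lp_norm_sum one_le_p) auto
  also have "\<dots> \<le> (\<Sum>S\<in>{S\<in>\<T>. S \<subseteq> T}. \<Sum>i\<in>I S. ennreal \<bar>C\<bar> * Lp_norm p T (\<zeta> S))"
    using T \<zeta> by (intro sum_mono basis_term_le) auto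
  finally show "Lp_norm p T (\<lambda>x. \<Sum>S\<in>{S\<in>\<T>. S \<subseteq> T}. \<Sum>i\<in>I S. \<phi>s S i (\<zeta> S) *\<^sub>R basis_rep T S i x) \<le>
      (\<Sum>S\<in>{S\<in>\<T>. S \<subseteq> T}. \<Sum>i\<in>I S. ennreal \<bar>C\<bar> * Lp_norm p T (\<zeta> S))" .
qed

lemma Lp_norm_diff_triangle:
  assumes "f \<in> borel_measurable (lebesgue_on U)" "g \<in> borel_measurable (lebesgue_on U)"
    "h \<in> borel_measurable (lebesgue_on U)"
  shows "Lp_norm p U (\<lambda>x. f x - h x) \<le> Lp_norm p U (\<lambda>x. f x - g x) + Lp_norm p U (\<lambda>x. g x - h x)"
  using Lp_norm_triangle [OF one_le_p borel_measurable_diff [OF assms(1,2)] borel_measurable_diff [OF assms(2,3)]]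
  by simp

text \<open>The triangle inequality bounds each \<open>proj_rep S \<omega>\<close> by
  \<open>1 + \<bar>C'\<bar>\<close> times \<open>B\<close>; each basis term contributes a factor
  \<open>\<bar>C\<bar>\<close>, and the number of terms gives the last factor. A common bound
  \<open>B\<close> leaves open over which set the norm of the datum is finally taken.\<close>

lemma clement_stable:
  assumes T: "T \<in> top_simplices \<T>" and \<omega>: "\<omega> \<in> Lp_forms p k \<Omega>"
    and B: "Lp_norm p T \<omega> \<le> B" "\<And>S. S \<in> \<T> \<Longrightarrow> S \<subseteq> T \<Longrightarrow> Lp_norm p (interior (patch \<T> S)) \<omega> \<le> B"
  shows "Lp_norm p T (clement \<omega>) \<le> ennreal (real local_dim_bound * (\<bar>C\<bar> * (1 + \<bar>C'\<bar>))) * B"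
proof -
  have meas: "\<omega> \<in> borel_measurable (lebesgue_on T)"
    using Lp_forms_restrict [OF \<omega> sets_top_simplex AE_top_simplex_in_domain] T by (simp add: Lp_forms_def)
  have rep: "Lp_norm p T (proj_rep S \<omega>) \<le> ennreal (1 + \<bar>C'\<bar>) * B" if S: "S \<in> \<T>" "S \<subseteq> T" for S
  proof -
    have poly: "proj_rep S \<omega> \<in> borel_measurable (lebesgue_on T)"
      by (intro borel_measurable_poly_forms [OF proj_rep(1)] S \<omega> sets_top_simplex T)
    have "Lp_norm p T (proj_rep S \<omega>) \<le> Lp_norm p T \<omega> + Lp_norm p T (\<lambda>x. proj_rep S \<omega> x - \<omega> x)"
      using Lp_norm_triangle [OF one_le_p meas borel_measurable_diff [OF poly meas]] by simp
    also have "Lp_norm p T (\<lambda>x. proj_rep S \<omega> x - \<omega> x) \<le> Lp_norm p (patch \<T> S) (\<omega> - P S \<omega>)"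
      using proj_error_le [OF T S \<omega>] by (simp add: Lp_norm_diff_commute [of p T "proj_rep S \<omega>"])
    also have "\<dots> \<le> ennreal \<bar>C'\<bar> * Lp_norm p (interior (patch \<T> S)) \<omega>"
      by (rule proj_stable [OF S(1) \<omega>])
    also have "Lp_norm p T \<omega> + ennreal \<bar>C'\<bar> * Lp_norm p (interior (patch \<T> S)) \<omega> \<le> B + ennreal \<bar>C'\<bar> * B"
      using S by (intro add_mono mult_left_mono B) auto
    also have "\<dots> = ennreal (1 + \<bar>C'\<bar>) * B"
      by (simp add: distrib_right)
    finally show ?thesis by (simp add: add_left_mono)
  qed
  have "Lp_norm p T (clement \<omega>) \<le>
      Lp_norm p T (\<lambda>x. \<Sum>S\<in>{S\<in>\<T>. S \<subseteq> T}. \<Sum>i\<in>I S. \<phi>s S i (proj_rep S \<omega>) *\<^sub>R basis_rep T S i x)"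
    using clement_AE [OF T \<omega>] \<omega> T
    by (intro Lp_norm_mono_AE one_le_p sets_top_simplex Lp_norm_basis_sum_le proj_rep) (auto elim!: eventually_mono)
  also have "\<dots> \<le> (\<Sum>S\<in>{S\<in>\<T>. S \<subseteq> T}. \<Sum>i\<in>I S. ennreal \<bar>C\<bar> * Lp_norm p T (proj_rep S \<omega>))"
    by (intro Lp_norm_basis_sum_le T proj_rep \<omega>)
  also have "\<dots> \<le> (\<Sum>S\<in>{S\<in>\<T>. S \<subseteq> T}. \<Sum>i\<in>I S. ennreal \<bar>C\<bar> * (ennreal (1 + \<bar>C'\<bar>) * B))"
    by (intro sum_mono mult_left_mono rep) auto
  also have "\<dots> \<le> ennreal (real local_dim_bound) * (ennreal \<bar>C\<bar> * (ennreal (1 + \<bar>C'\<bar>) * B))"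
    by (rule sum_subsimplices_const_le [OF T])
  also have "\<dots> = ennreal (real local_dim_bound * (\<bar>C\<bar> * (1 + \<bar>C'\<bar>))) * B"
    by (simp add: ennreal_mult mult.assoc del: ennreal_plus)
  finally show ?thesis .
qed

text \<open>The summand 1 in the first constant is the error of \<open>\<psi>\<close> itself. That
  error returns once in every term of the expansion of \<open>\<psi> - clement \<omega>\<close>,
  whence the factor \<open>local_dim_bound\<close>; the projection errors stay under the sum and
  cost only \<open>\<bar>C\<bar>\<close>.\<close>

lemma clement_error:
  assumes T: "T \<in> top_simplices \<T>" and \<omega>: "\<omega> \<in> Lp_forms p k \<Omega>" and \<psi>: "\<psi> \<in> fe_forms fam r k"
  defines "E \<equiv> Lp_norm p T (\<lambda>x. \<omega> x - \<psi> x)"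
  shows "Lp_norm p T (\<omega> - clement \<omega>) \<le> ennreal (1 + real local_dim_bound * \<bar>C\<bar>) * E +
    ennreal \<bar>C\<bar> * (\<Sum>S\<in>{S\<in>\<T>. S \<subseteq> T}. \<Sum>i\<in>I S. Lp_norm p (patch \<T> S) (\<omega> - P S \<omega>))"
proof -
  let ?A = "{S\<in>\<T>. S \<subseteq> T}"
  let ?D = "\<lambda>S. Lp_norm p (patch \<T> S) (\<omega> - P S \<omega>)"
  define \<zeta> where "\<zeta> S = \<psi> - proj_rep S \<omega>" for S
  define \<sigma> where "\<sigma> = (\<lambda>x. \<Sum>S\<in>?A. \<Sum>i\<in>I S. \<phi>s S i (\<zeta> S) *\<^sub>R basis_rep T S i x)"
  have \<zeta>: "\<zeta> S \<in> poly_forms (int r) (int k)" if "S \<in> \<T>" for S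
    unfolding \<zeta>_def by (intro subspace_diff [OF subspace_poly_forms] fe_forms_poly \<psi> proj_rep that \<omega>)
  have meas: "\<omega> \<in> borel_measurable (lebesgue_on T)"
    using Lp_forms_restrict [OF \<omega> sets_top_simplex AE_top_simplex_in_domain] T by (simp add: Lp_forms_def)
  have meas_\<psi>: "\<psi> \<in> borel_measurable (lebesgue_on T)"
    by (intro borel_measurable_poly_forms [OF fe_forms_poly] \<psi> sets_top_simplex T)
  have meas_\<sigma>: "\<sigma> \<in> borel_measurable (lebesgue_on T)"
    unfolding \<sigma>_def by (intro Lp_norm_basis_sum_le T \<zeta>)
  have \<zeta>_le: "Lp_norm p T (\<zeta> S) \<le> E + ?D S" if S: "S \<in> \<T>" "S \<subseteq> T" for S
  proof -
    have poly: "proj_rep S \<omega> \<in> borel_measurable (lebesgue_on T)"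
      by (intro borel_measurable_poly_forms [OF proj_rep(1)] S \<omega> sets_top_simplex T)
    have "Lp_norm p T (\<zeta> S) \<le> Lp_norm p T (\<lambda>x. \<psi> x - \<omega> x) + Lp_norm p T (\<lambda>x. \<omega> x - proj_rep S \<omega> x)"
      unfolding \<zeta>_def fun_diff_def by (rule Lp_norm_diff_triangle [OF meas_\<psi> meas poly])
    also have "\<dots> \<le> E + ?D S"
      unfolding E_def Lp_norm_diff_commute [of p T \<psi>] by (intro add_left_mono proj_error_le T S \<omega>)
    finally show ?thesis .
  qed
  have AE: "AE x in lebesgue. x \<in> T \<longrightarrow> (\<omega> - clement \<omega>) x = (\<omega> x - \<psi> x) + \<sigma> x"
    using clement_AE [OF T \<omega>]
  proof eventually_elim
    case (elim x)
    show ?case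
    proof
      assume x: "x \<in> T"
      have "\<sigma> x = (\<Sum>S\<in>?A. \<Sum>i\<in>I S. \<phi>s S i \<psi> *\<^sub>R basis_rep T S i x -
          \<phi>s S i (proj_rep S \<omega>) *\<^sub>R basis_rep T S i x)"
        unfolding \<sigma>_def \<zeta>_def using proj_rep(1) [OF _ \<omega>] fe_forms_poly [OF \<psi>]
        by (intro sum.cong refl) (auto simp: dof_diff scaleR_diff_left)
      also have "\<dots> = \<psi> x - clement \<omega> x"
        using elim x local_reproduction [OF T \<psi> x] by (simp add: sum_subtractf)
      finally show "(\<omega> - clement \<omega>) x = (\<omega> x - \<psi> x) + \<sigma> x"
        by simp
    qed
  qed
  have "Lp_norm p T (\<omega> - clement \<omega>) \<le> Lp_norm p T (\<lambda>x. (\<omega> x - \<psi> x) + \<sigma> x)"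
    using AE by (intro Lp_norm_mono_AE one_le_p sets_top_simplex T borel_measurable_add borel_measurable_diff
        meas meas_\<psi> meas_\<sigma>) (auto elim!: eventually_mono)
  also have "\<dots> \<le> E + Lp_norm p T \<sigma>"
    unfolding E_def by (intro Lp_norm_triangle one_le_p borel_measurable_diff meas meas_\<psi> meas_\<sigma>)
  also have "Lp_norm p T \<sigma> \<le> (\<Sum>S\<in>?A. \<Sum>i\<in>I S. ennreal \<bar>C\<bar> * Lp_norm p T (\<zeta> S))"
    unfolding \<sigma>_def by (intro Lp_norm_basis_sum_le T \<zeta>)
  also have "\<dots> \<le> (\<Sum>S\<in>?A. \<Sum>i\<in>I S. ennreal \<bar>C\<bar> * (E + ?D S))"
    by (intro sum_mono mult_left_mono \<zeta>_le) auto
  also have "\<dots> = (\<Sum>S\<in>?A. \<Sum>i\<in>I S. ennreal \<bar>C\<bar> * E) + ennreal \<bar>C\<bar> * (\<Sum>S\<in>?A. \<Sum>i\<in>I S. ?D S)"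
    by (simp only: distrib_left sum.distrib sum_distrib_left)
  also have "(\<Sum>S\<in>?A. \<Sum>i\<in>I S. ennreal \<bar>C\<bar> * E) \<le> ennreal (real local_dim_bound) * (ennreal \<bar>C\<bar> * E)"
    by (rule sum_subsimplices_const_le [OF T])
  finally have "Lp_norm p T (\<omega> - clement \<omega>) \<le> E + (ennreal (real local_dim_bound) * (ennreal \<bar>C\<bar> * E) +
      ennreal \<bar>C\<bar> * (\<Sum>S\<in>?A. \<Sum>i\<in>I S. ?D S))"
    by (simp only: add_left_mono add_right_mono)
  also have "\<dots> = ennreal (1 + real local_dim_bound * \<bar>C\<bar>) * E + ennreal \<bar>C\<bar> * (\<Sum>S\<in>?A. \<Sum>i\<in>I S. ?D S)"
    by (simp add: distrib_right ennreal_mult mult.assoc add.assoc)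
  finally show ?thesis .
qed

lemma extension_Lp_forms:
  assumes \<omega>: "\<omega> \<in> Lp_forms p k U" and U: "U \<in> sets lebesgue"
  shows "(\<lambda>x. if x \<in> U then \<omega> x else 0) \<in> Lp_forms p k \<Omega>"
proof -
  have meas: "\<omega> \<in> borel_measurable (lebesgue_on U)" and fin: "Lp_norm p U \<omega> < \<infinity>"
    and cov: "AE x in lebesgue_on U. \<omega> x \<in> covectors k"
    using \<omega> by (auto simp: Lp_forms_def)
  have "AE x in lebesgue. x \<in> U \<longrightarrow> \<omega> x \<in> covectors k"
    using cov U by (subst (asm) AE_restrict_space_iff) auto
  then have "AE x in lebesgue. x \<in> \<Omega> \<longrightarrow> (if x \<in> U then \<omega> x else 0) \<in> covectors k"
    by (auto elim!: eventually_mono simp: subspace_0 [OF subspace_covectors])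
  then have "AE x in lebesgue_on \<Omega>. (if x \<in> U then \<omega> x else 0) \<in> covectors k"
    using sets_domain by (subst AE_restrict_space_iff) auto
  moreover have "(\<lambda>x. if x \<in> U then \<omega> x else 0) \<in> borel_measurable (lebesgue_on \<Omega>)"
    by (rule borel_measurable_lebesgue_on_AE [OF meas U sets_domain]) simp
  moreover have "Lp_norm p \<Omega> (\<lambda>x. if x \<in> U then \<omega> x else 0) \<le> Lp_norm p U \<omega>"
    by (rule Lp_norm_mono_AE [OF one_le_p meas U sets_domain]) simp
  ultimately show ?thesis
    using fin by (auto simp: Lp_forms_def intro: le_less_trans)
qed

text \<open>The norm of an extension by zero over any measurable set is at most the norm over the
  star. This supplies the common bound for \<open>T\<close> and all the patches.\<close>

lemma clement_stable_patch_star: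
  assumes T: "T \<in> top_simplices \<T>" and \<omega>: "\<omega> \<in> Lp_forms p k (patch_star \<T> T)"
  shows "Lp_norm p T (clement (\<lambda>x. if x \<in> patch_star \<T> T then \<omega> x else 0)) \<le>
    ennreal (real local_dim_bound * (\<bar>C\<bar> * (1 + \<bar>C'\<bar>))) * Lp_norm p (patch_star \<T> T) \<omega>"
proof (rule clement_stable [OF T extension_Lp_forms [OF \<omega> sets_patch_star]])
  have le: "Lp_norm p U (\<lambda>x. if x \<in> patch_star \<T> T then \<omega> x else 0) \<le> Lp_norm p (patch_star \<T> T) \<omega>"
    if "U \<in> sets lebesgue" for U
    using \<omega> that by (intro Lp_norm_mono_AE one_le_p sets_patch_star) (auto simp: Lp_forms_def)
  show "Lp_norm p T (\<lambda>x. if x \<in> patch_star \<T> T then \<omega> x else 0) \<le> Lp_norm p (patch_star \<T> T) \<omega>"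
    by (rule le [OF sets_top_simplex [OF T]])
  show "Lp_norm p (interior (patch \<T> S)) (\<lambda>x. if x \<in> patch_star \<T> T then \<omega> x else 0) \<le>
      Lp_norm p (patch_star \<T> T) \<omega>" for S
    by (rule le) (simp add: borel_open)
qed

text \<open>\<open>Q T \<omega>\<close> is polynomial only up to a null set, so
  \<open>clement_error\<close> is applied to the form that represents it and the norm is carried
  back.\<close>

lemma clement_error_projection:
  assumes T: "T \<in> top_simplices \<T>" and \<omega>: "\<omega> \<in> Lp_forms p k \<Omega>"
    and Q: "simplex_projections C'' p fam r k \<T> Q"
  shows "Lp_norm p T (\<omega> - clement \<omega>) \<le>
    ennreal (1 + real local_dim_bound * \<bar>C\<bar>) * Lp_norm p T (\<omega> - Q T \<omega>) +
    ennreal \<bar>C\<bar> * (\<Sum>S\<in>{S\<in>\<T>. S \<subseteq> T}. \<Sum>i\<in>I S. Lp_norm p (patch \<T> S) (\<omega> - P S \<omega>))"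
proof -
  note sT = sets_top_simplex [OF T]
  have \<omega>T: "\<omega> \<in> Lp_forms p k T"
    using Lp_forms_restrict [OF \<omega> sT AE_top_simplex_in_domain [OF T]] .
  have lin: "Lp_bounded_linear p k T (Q T)"
    and "\<forall>\<omega>\<in>Lp_forms p k T. \<exists>\<eta>\<in>fe_forms fam r k. ae_eq_on T (Q T \<omega>) \<eta>"
    using Q T by (simp_all add: simplex_projections_def)
  then obtain \<psi> where \<psi>: "\<psi> \<in> fe_forms fam r k" "ae_eq_on T (Q T \<omega>) \<psi>"
    using \<omega>T by blast
  have "Q T \<omega> \<in> Lp_forms p k T"
    using lin \<omega>T by (simp add: Lp_bounded_linear_def)
  then have "\<omega> - Q T \<omega> \<in> borel_measurable (lebesgue_on T)"
    using \<omega>T unfolding fun_diff_def by (intro borel_measurable_diff) (auto simp: Lp_forms_def)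
  moreover have "AE x in lebesgue. x \<in> T \<longrightarrow> \<omega> x - \<psi> x = (if x \<in> T then (\<omega> - Q T \<omega>) x else 0)"
    using \<psi>(2) unfolding ae_eq_on_iff [OF sT] by (auto elim!: eventually_mono)
  ultimately have "Lp_norm p T (\<lambda>x. \<omega> x - \<psi> x) \<le> Lp_norm p T (\<omega> - Q T \<omega>)"
    by (intro Lp_norm_mono_AE one_le_p sT)
  then show ?thesis
    using clement_error [OF T \<omega> \<psi>(1)]
    by (elim order_trans) (intro add_right_mono mult_left_mono, auto)
qed

end

theorem theorem6p1:
  fixes C_A C_BH C_Pi :: "ennreal \<Rightarrow> nat \<Rightarrow> real \<Rightarrow> real"
  shows "\<exists>C_I :: ennreal \<Rightarrow> nat \<Rightarrow> real \<Rightarrow> real. (\<forall>p r \<mu>. 0 < C_I p r \<mu>) \<and>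
    (\<forall>(\<T> :: ('n::{finite,linorder}) point set set) \<Omega> p r k fam \<phi> \<phi>s P Q.
      triangulates \<T> \<Omega> \<and> face_connected \<T> \<and> 1 \<le> p \<and> 1 \<le> r \<and>
      (k = 0 \<longrightarrow> fam = Full) \<and> (k = CARD('n) \<longrightarrow> fam = Trimmed) \<and>
      biorthogonal_system (C_A p r (shape_measure \<T>)) p fam r k \<T> \<Omega> \<phi> \<phi>s \<and>
      patch_projections (C_BH p r (shape_measure \<T>)) p r k \<T> \<Omega> P \<and>
      simplex_projections (C_Pi p r (shape_measure \<T>)) p fam r k \<T> Q \<longrightarrow>
      (\<forall>T\<in>top_simplices \<T>. \<forall>\<omega>\<in>Lp_forms p k (patch_star \<T> T).
        Lp_norm p T (clement_interpolant fam r k \<T> \<phi> \<phi>s P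
            (\<lambda>x. if x \<in> patch_star \<T> T then \<omega> x else 0))
          \<le> ennreal (C_I p r (shape_measure \<T>)) * Lp_norm p (patch_star \<T> T) \<omega>) \<and>
      (\<forall>T\<in>top_simplices \<T>. \<forall>\<omega>\<in>Lp_forms p k \<Omega>.
        Lp_norm p T (\<omega> - clement_interpolant fam r k \<T> \<phi> \<phi>s P \<omega>)
          \<le> ennreal (C_I p r (shape_measure \<T>)) * Lp_norm p T (\<omega> - Q T \<omega>) +
            ennreal (C_I p r (shape_measure \<T>)) *
              (\<Sum>S\<in>{S\<in>\<T>. S \<subseteq> T}. \<Sum>i\<in>fe_index fam r k S.
                Lp_norm p (patch \<T> S) (\<omega> - P S \<omega>))))"
proof -
  \<comment> \<open>The value of \<open>local_dim_bound\<close>, written out because the constant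
    must be given before any triangulation is at hand.\<close>
  define N where "N r = real (2 ^ (CARD('n) + 1) *
    (card {\<alpha> :: 'n \<Rightarrow> nat. sum \<alpha> UNIV \<le> r} * CARD('n set)))" for r
  \<comment> \<open>The summands 1 make the product positive for arbitrary given constants and let
    it dominate each of the three factors that occur in the two estimates.\<close>
  define C_I where "C_I p r \<mu> = (1 + N r) * (1 + \<bar>C_A p r \<mu>\<bar>) * (1 + \<bar>C_BH p r \<mu>\<bar>)" for p r \<mu>
  have N: "0 \<le> N r" for r
    by (simp add: N_def)
  \<comment> \<open>After expansion every left-hand side appears among the nonnegative terms on the
    right.\<close>
  have le: "(1 + n) * (1 + a) \<le> (1 + n) * (1 + a) * (1 + b)" "n * (a * (1 + b)) \<le> (1 + n) * (1 + a) * (1 + b)"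
    "1 + n * a \<le> (1 + n) * (1 + a)" "a \<le> (1 + n) * (1 + a)"
    if "0 \<le> n" "0 \<le> a" "0 \<le> b" for n a b :: real
    using that by (simp_all add: algebra_simps add_nonneg_nonneg)
  have bounds: "N r * (\<bar>C_A p r \<mu>\<bar> * (1 + \<bar>C_BH p r \<mu>\<bar>)) \<le> C_I p r \<mu>"
    "1 + N r * \<bar>C_A p r \<mu>\<bar> \<le> C_I p r \<mu>" "\<bar>C_A p r \<mu>\<bar> \<le> C_I p r \<mu>" for p r \<mu>
    using le [of "N r" "\<bar>C_A p r \<mu>\<bar>" "\<bar>C_BH p r \<mu>\<bar>", OF N abs_ge_zero abs_ge_zero] unfolding C_I_def by linarith+
  show ?thesis
  proof (intro exI [of _ C_I] conjI allI impI ballI, goal_cases)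
    case (1 p r \<mu>)
    show ?case
      using N [of r] unfolding C_I_def by (intro mult_pos_pos) auto
  next
    case (2 \<T> \<Omega> p r k fam \<phi> \<phi>s P Q T \<omega>)
    then interpret clement_setting \<T> \<Omega> "C_A p r (shape_measure \<T>)" p fam r k \<phi> \<phi>s
        "C_BH p r (shape_measure \<T>)" P
      by unfold_locales auto
    have eq: "real local_dim_bound = N r"
      by (simp add: local_dim_bound_def N_def)
    show ?case
      by (rule order_trans [OF clement_stable_patch_star [OF 2(2,3), unfolded eq]])
        (intro ennreal_mono_mult bounds order_refl)
  next
    case (3 \<T> \<Omega> p r k fam \<phi> \<phi>s P Q T \<omega>)
    then interpret clement_setting \<T> \<Omega> "C_A p r (shape_measure \<T>)" p fam r k \<phi> \<phi>s
        "C_BH p r (shape_measure \<T>)" P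
      by unfold_locales auto
    have eq: "real local_dim_bound = N r"
      by (simp add: local_dim_bound_def N_def)
    have Q: "simplex_projections (C_Pi p r (shape_measure \<T>)) p fam r k \<T> Q"
      using 3(1) by simp
    show ?case
      by (rule order_trans [OF clement_error_projection [OF 3(2,3) Q, unfolded eq]])
        (intro add_mono ennreal_mono_mult bounds order_refl)
  qed
qed

end
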